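(* For every integer $n\ge2$, $c_1(\mathrm{TC}(Gr_n))\ge5760^{-1}(n-1)$, where $Gr_n$ denotes $\{0,\dots,2^n\}^2$ with the $\ell_1$-metric.
   Context: For a finite metric space $(X,d)$, $\mathrm{TC}(X)$ is the space of signed measures $\mu$ on $X$ with $\mu(X)=0$ normed by $\|\mu\|_{\mathrm{TC}}=\inf\sum_ia_id(x_i,y_i)$ over representations $\mu=\sum_ia_i(\delta_{x_i}-\delta_{y_i})$, $a_i\ge0$. For a metric space $Y$, $c_1(Y)$ is the infimal $D\ge1$ such that some map $F$ of $Y$ into an $L_1$-space satisfies $\rho(x,y)\le\|F(x)-F(y)\|_1\le D\rho(x,y)$. *)

theory Defs
  imports "HOL-Analysis.Analysis"
begin

definition Gr :: "nat \<Rightarrow> (int \<times> int) set" where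
  "Gr n = {0..2^n} \<times> {0..2^n}"

definition l1dist :: "int \<times> int \<Rightarrow> int \<times> int \<Rightarrow> real" where
  "l1dist p q = real_of_int (\<bar>fst p - fst q\<bar> + \<bar>snd p - snd q\<bar>)"

text \<open>TC(X): signed measures on the finite set X (functions supported on X) of total mass 0.\<close>
definition TC :: "'p set \<Rightarrow> ('p \<Rightarrow> real) set" where
  "TC X = {\<mu>. (\<forall>p. p \<notin> X \<longrightarrow> \<mu> p = 0) \<and> (\<Sum>p\<in>X. \<mu> p) = 0}"

definition tc_norm :: "'p set \<Rightarrow> ('p \<Rightarrow> 'p \<Rightarrow> real) \<Rightarrow> ('p \<Rightarrow> real) \<Rightarrow> real" where
  "tc_norm X d \<mu> = Inf {(\<Sum>i<k. a i * d (x i) (y i)) | (k::nat) a x y.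
      (\<forall>i<k. a i \<ge> 0 \<and> x i \<in> X \<and> y i \<in> X) \<and>
      (\<forall>p. \<mu> p = (\<Sum>i<k. a i * ((if p = x i then 1 else 0) - (if p = y i then 1 else 0))))}"

definition tc_dist :: "'p set \<Rightarrow> ('p \<Rightarrow> 'p \<Rightarrow> real) \<Rightarrow> ('p \<Rightarrow> real) \<Rightarrow> ('p \<Rightarrow> real) \<Rightarrow> real" where
  "tc_dist X d \<mu> \<nu> = tc_norm X d (\<lambda>p. \<mu> p - \<nu> p)"

definition L1_embedding :: "'y set \<Rightarrow> ('y \<Rightarrow> 'y \<Rightarrow> real) \<Rightarrow> 'a measure \<Rightarrow> ('y \<Rightarrow> 'a \<Rightarrow> real) \<Rightarrow> real \<Rightarrow> bool" where
  "L1_embedding Y \<rho> M F D \<longleftrightarrow> D \<ge> 1 \<and> (\<forall>y\<in>Y. integrable M (F y)) \<and>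
     (\<forall>x\<in>Y. \<forall>y\<in>Y. \<rho> x y \<le> (\<integral>t. \<bar>F x t - F y t\<bar> \<partial>M) \<and> (\<integral>t. \<bar>F x t - F y t\<bar> \<partial>M) \<le> D * \<rho> x y)"

end

theory Submission
  imports Defs "HOL-Library.Function_Algebras"
begin

text \<open>
  Averaging \<open>F\<close> over a large box of lattice translates makes its differences almost additive, so that up
  to a vanishing error \<open>F\<close> is, pointwise in the measure space, a real function \<open>f\<close> on the grid acting
  linearly on signed measures. Its expected total variation is at most \<open>D\<close> times the number of edges.
  On the other hand, take at each scale \<open>s = 2\<^sup>j\<close> the measure that is \<open>1\<close> on the left half and \<open>-1\<close> on the right
  half of each \<open>2s \<times> s\<close> cell, with independent random signs on the cells. Its transportation norm is of
  order \<open>s N\<^sup>2\<close>, where \<open>N = 2\<^sup>n\<close>. Its pairing with \<open>f\<close> is on average at most the \<open>\<ell>\<^sub>2\<close>-norm of the Haar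
  coefficients of \<open>f\<close> at scale \<open>s\<close>. By the coarea formula it is enough to look at indicators, and for a set of
  perimeter \<open>P\<close> this norm divided by \<open>s\<close> is at most \<open>min (sqrt (s P)) (P\<^sup>2 / s)\<close>: the first bound is a Poincare
  inequality and the second one the isoperimetric inequality. The sum over the scales is therefore \<open>O(P)\<close>
  independently of their number, whereas the normalised transportation norms add up to order \<open>n N\<^sup>2\<close>.
\<close>

subsection \<open>Averages over boxes\<close>

text \<open>Multiples are formed by repeated addition, since the averages run over an abelian group
  without scalars, later that of integer-valued functions.\<close>

definition nmul :: "nat \<Rightarrow> 'v::ab_group_add \<Rightarrow> 'v" where
  "nmul k v = (\<Sum>i<k. v)"

lemma nmul_0 [simp]: "nmul 0 v = 0"
  by (simp add: nmul_def)

lemma nmul_Suc [simp]: "nmul (Suc k) v = nmul k v + v"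
  by (simp add: nmul_def)

definition avg :: "nat \<Rightarrow> 'v::ab_group_add \<Rightarrow> ('v \<Rightarrow> real) \<Rightarrow> 'v \<Rightarrow> real" where
  "avg L v \<phi> x = (\<Sum>k<L. \<phi> (x + nmul k v)) / real L"

text \<open>Uniform average over the box spanned by the listed directions, with \<open>L\<close>
  steps in each. By \<open>avg_commute\<close> the order of the list is immaterial.\<close>

primrec avgs :: "nat \<Rightarrow> 'v::ab_group_add list \<Rightarrow> ('v \<Rightarrow> real) \<Rightarrow> 'v \<Rightarrow> real" where
  "avgs L [] \<phi> = \<phi>"
| "avgs L (v # vs) \<phi> = avgs L vs (avg L v \<phi>)"

lemma avg_commute: "avg L u (avg L v \<phi>) = avg L v (avg L u \<phi>)"
proof
  fix x
  show "avg L u (avg L v \<phi>) x = avg L v (avg L u \<phi>) x"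
    unfolding avg_def sum_divide_distrib [symmetric]
    by (subst sum.swap) (simp add: add_ac)
qed

lemma avg_diff: "avg L v (\<lambda>y. \<phi> y - \<psi> y) = (\<lambda>x. avg L v \<phi> x - avg L v \<psi> x)"
  by (simp add: fun_eq_iff avg_def sum_subtractf diff_divide_distrib)

lemma avg_shift: "avg L v (\<lambda>y. \<phi> (y + w)) = (\<lambda>x. avg L v \<phi> (x + w))"
  by (simp add: fun_eq_iff avg_def add_ac)

lemma avg_lincomb:
  "avg L v (\<lambda>y. \<Sum>i\<in>I. a i * \<phi> i y) = (\<lambda>x. \<Sum>i\<in>I. a i * avg L v (\<phi> i) x)"
proof
  fix x
  show "avg L v (\<lambda>y. \<Sum>i\<in>I. a i * \<phi> i y) x = (\<Sum>i\<in>I. a i * avg L v (\<phi> i) x)"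
    unfolding avg_def
    by (subst sum.swap) (simp add: sum_divide_distrib sum_distrib_left)
qed

lemma avg_mono:
  assumes "\<And>x. \<phi> x \<le> \<psi> x"
  shows "avg L v \<phi> x \<le> avg L v \<psi> x"
  unfolding avg_def by (intro divide_right_mono sum_mono assms) auto

lemma avg_const: "L > 0 \<Longrightarrow> avg L v (\<lambda>_. c) = (\<lambda>_. c)"
  by (simp add: fun_eq_iff avg_def)

lemma avg_telescope:
  "avg L v (\<lambda>y. \<phi> (y + v) - \<phi> y) x = (\<phi> (x + nmul L v) - \<phi> x) / real L"
proof -
  have "(\<Sum>k<L. \<phi> (x + nmul k v + v) - \<phi> (x + nmul k v)) = \<phi> (x + nmul L v) - \<phi> x"
    using sum_lessThan_telescope [of "\<lambda>k. \<phi> (x + nmul k v)" L] by (simp add: add.assoc)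
  then show ?thesis
    by (simp add: avg_def)
qed

lemma avgs_diff: "avgs L vs (\<lambda>y. \<phi> y - \<psi> y) = (\<lambda>x. avgs L vs \<phi> x - avgs L vs \<psi> x)"
  by (induction vs arbitrary: \<phi> \<psi>) (simp_all add: avg_diff)

lemma avgs_shift: "avgs L vs (\<lambda>y. \<phi> (y + w)) = (\<lambda>x. avgs L vs \<phi> (x + w))"
  by (induction vs arbitrary: \<phi>) (simp_all add: avg_shift)

lemma avgs_lincomb:
  "avgs L vs (\<lambda>y. \<Sum>i\<in>I. a i * \<phi> i y) = (\<lambda>x. \<Sum>i\<in>I. a i * avgs L vs (\<phi> i) x)"
  by (induction vs arbitrary: \<phi>) (simp_all add: avg_lincomb)

lemma avgs_le:
  assumes "L > 0" "\<And>x. \<phi> x \<le> c"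
  shows "avgs L vs \<phi> x \<le> c"
  using assms(2)
proof (induction vs arbitrary: \<phi>)
  case (Cons v vs)
  have "avg L v \<phi> y \<le> c" for y
    using avg_mono [of \<phi> "\<lambda>_. c" L v y] Cons.prems assms(1) by (simp add: avg_const)
  then show ?case
    using Cons.IH by simp
qed simp

lemma avgs_ge:
  assumes "L > 0" "\<And>x. c \<le> \<phi> x"
  shows "c \<le> avgs L vs \<phi> x"
  using assms(2)
proof (induction vs arbitrary: \<phi>)
  case (Cons v vs)
  have "c \<le> avg L v \<phi> y" for y
    using avg_mono [of "\<lambda>_. c" \<phi> L v y] Cons.prems assms(1) by (simp add: avg_const)
  then show ?case
    using Cons.IH by simp
qed simp

text \<open>Averages commute, so the one in direction \<open>v\<close> may be carried out first; the
  remaining ones preserve a constant lower bound.\<close>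

lemma avgs_ge_mem:
  assumes "L > 0" "v \<in> set vs" "\<And>x. c \<le> avg L v \<phi> x"
  shows "c \<le> avgs L vs \<phi> x"
  using assms(2,3)
proof (induction vs arbitrary: \<phi>)
  case (Cons u vs)
  show ?case
  proof (cases "v = u")
    case True
    then show ?thesis
      using avgs_ge [OF assms(1), of c "avg L v \<phi>" vs] Cons.prems by simp
  next
    case False
    have "c \<le> avg L u (avg L v \<phi>) y" for y
      using avg_mono [of "\<lambda>_. c" "avg L v \<phi>" L u y] Cons.prems assms(1) by (simp add: avg_const)
    then show ?thesis
      using Cons False by (simp add: avg_commute [of L u v])
  qed
qed simp

section \<open>Averages of integrable families in the L_1-norm\<close>

lemma L1_triangle:
  fixes f g :: "'a \<Rightarrow> real"
  assumes "integrable M f" "integrable M g"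
  shows "(\<integral>t. \<bar>f t + g t\<bar> \<partial>M) \<le> (\<integral>t. \<bar>f t\<bar> \<partial>M) + (\<integral>t. \<bar>g t\<bar> \<partial>M)"
proof -
  have "(\<integral>t. \<bar>f t + g t\<bar> \<partial>M) \<le> (\<integral>t. \<bar>f t\<bar> + \<bar>g t\<bar> \<partial>M)"
    using assms by (intro integral_mono) auto
  then show ?thesis
    using assms by simp
qed

lemma L1_triangle_diff:
  fixes f g :: "'a \<Rightarrow> real"
  assumes "integrable M f" "integrable M g"
  shows "(\<integral>t. \<bar>f t - g t\<bar> \<partial>M) \<le> (\<integral>t. \<bar>f t\<bar> \<partial>M) + (\<integral>t. \<bar>g t\<bar> \<partial>M)"
  using L1_triangle [of M f "\<lambda>t. - g t"] assms by simp

lemma L1_triangle_sum: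
  fixes f :: "'i \<Rightarrow> 'a \<Rightarrow> real"
  assumes "\<And>i. i \<in> I \<Longrightarrow> integrable M (f i)"
  shows "(\<integral>t. \<bar>\<Sum>i\<in>I. f i t\<bar> \<partial>M) \<le> (\<Sum>i\<in>I. \<integral>t. \<bar>f i t\<bar> \<partial>M)"
proof -
  have "(\<integral>t. \<bar>\<Sum>i\<in>I. f i t\<bar> \<partial>M) \<le> (\<integral>t. (\<Sum>i\<in>I. \<bar>f i t\<bar>) \<partial>M)"
    using assms by (intro integral_mono) (auto intro!: integrable_sum integrable_abs)
  also have "\<dots> = (\<Sum>i\<in>I. \<integral>t. \<bar>f i t\<bar> \<partial>M)"
    using assms by (intro Bochner_Integration.integral_sum) auto
  finally show ?thesis .
qed

lemma integrable_avg:
  assumes "\<And>x. integrable M (G x)"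
  shows "integrable M (\<lambda>t. avg L v (\<lambda>y. G y t) x)"
  unfolding avg_def using assms by auto

lemma L1_avg_le:
  assumes "L > 0" "\<And>x. integrable M (G x)" "\<And>k. k < L \<Longrightarrow> (\<integral>t. \<bar>G (x + nmul k v) t\<bar> \<partial>M) \<le> c"
  shows "(\<integral>t. \<bar>avg L v (\<lambda>y. G y t) x\<bar> \<partial>M) \<le> c"
proof -
  have "(\<integral>t. \<bar>avg L v (\<lambda>y. G y t) x\<bar> \<partial>M) = (\<integral>t. \<bar>\<Sum>k<L. G (x + nmul k v) t\<bar> \<partial>M) / real L"
    by (simp add: avg_def)
  also have "\<dots> \<le> (\<Sum>k<L. \<integral>t. \<bar>G (x + nmul k v) t\<bar> \<partial>M) / real L"
    using assms by (intro divide_right_mono L1_triangle_sum) auto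
  also have "\<dots> \<le> (\<Sum>k<L. c) / real L"
    using assms by (intro divide_right_mono sum_mono) auto
  finally show ?thesis
    using assms(1) by simp
qed

lemma integrable_avgs:
  assumes "\<And>x. integrable M (G x)"
  shows "integrable M (\<lambda>t. avgs L vs (\<lambda>y. G y t) x)"
  using assms
proof (induction vs arbitrary: G)
  case (Cons v vs)
  show ?case
    using Cons.IH [of "\<lambda>x t. avg L v (\<lambda>y. G y t) x"] integrable_avg [of M G] Cons.prems by simp
qed simp

lemma L1_avgs_le:
  assumes "L > 0" "\<And>x. integrable M (G x)" "\<And>x. (\<integral>t. \<bar>G x t\<bar> \<partial>M) \<le> c"
  shows "(\<integral>t. \<bar>avgs L vs (\<lambda>y. G y t) x\<bar> \<partial>M) \<le> c"
  using assms(2,3)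
proof (induction vs arbitrary: G)
  case (Cons v vs)
  have "(\<integral>t. \<bar>avg L v (\<lambda>y. G y t) x\<bar> \<partial>M) \<le> c" for x
    by (rule L1_avg_le) (use assms(1) Cons.prems in auto)
  then show ?case
    using Cons.IH [of "\<lambda>x t. avg L v (\<lambda>y. G y t) x"] integrable_avg [of M G] Cons.prems by simp
qed simp

text \<open>Counterpart of \<open>avgs_ge_mem\<close> for norms: direction \<open>v\<close> is moved
  to the front, and further averaging does not increase a uniform bound.\<close>

lemma L1_avgs_le_mem:
  assumes "L > 0" "\<And>x. integrable M (G x)" "v \<in> set vs"
    and "\<And>x. (\<integral>t. \<bar>avg L v (\<lambda>y. G y t) x\<bar> \<partial>M) \<le> c"
  shows "(\<integral>t. \<bar>avgs L vs (\<lambda>y. G y t) x\<bar> \<partial>M) \<le> c"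
  using assms(2,3,4)
proof (induction vs arbitrary: G)
  case (Cons u vs)
  show ?case
  proof (cases "v = u")
    case True
    then show ?thesis
      using L1_avgs_le [OF assms(1), of M "\<lambda>x t. avg L v (\<lambda>y. G y t) x" c vs x]
        integrable_avg [of M G] Cons.prems by simp
  next
    case False
    have "(\<integral>t. \<bar>avg L u (avg L v (\<lambda>y. G y t)) x\<bar> \<partial>M) \<le> c" for x
      by (rule L1_avg_le [of L M "\<lambda>x t. avg L v (\<lambda>y. G y t) x"])
        (use assms(1) Cons.prems integrable_avg [of M G] in auto)
    then have "(\<integral>t. \<bar>avg L v (avg L u (\<lambda>y. G y t)) x\<bar> \<partial>M) \<le> c" for x
      by (simp add: avg_commute [of L v u])
    then show ?thesis
      using Cons.IH [of "\<lambda>x t. avg L u (\<lambda>y. G y t) x"] integrable_avg [of M G] Cons.prems False by simp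
  qed
qed simp

text \<open>Averaging commutes with translations, so the difference is an average of translated
  differences, all of which obey the same bound because \<open>B\<close> sees only
  \<open>x - y\<close>.\<close>

lemma avgs_Lipschitz:
  assumes "L > 0" "\<And>x. integrable M (F x)" "\<And>x y. (\<integral>t. \<bar>F x t - F y t\<bar> \<partial>M) \<le> B (x - y)"
  shows "(\<integral>t. \<bar>avgs L vs (\<lambda>y. F y t) x - avgs L vs (\<lambda>y. F y t) y\<bar> \<partial>M) \<le> B (x - y)"
proof -
  have "avgs L vs (\<lambda>y. F y t) x - avgs L vs (\<lambda>y. F y t) y
      = avgs L vs (\<lambda>z. F (z + (x - y)) t - F z t) y" for t
    using fun_cong [OF avgs_shift [of L vs "\<lambda>y. F y t" "x - y"], of y] by (simp add: avgs_diff)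
  moreover have "(\<integral>t. \<bar>F (z + (x - y)) t - F z t\<bar> \<partial>M) \<le> B (x - y)" for z
    using assms(3) [of "z + (x - y)" z] by simp
  ultimately show ?thesis
    using L1_avgs_le [OF assms(1), of M "\<lambda>z t. F (z + (x - y)) t - F z t" "B (x - y)" vs y] assms(2)
    by simp
qed

text \<open>Each average moves the argument by finitely many fixed vectors. The radius
  \<open>R\<close> may depend on \<open>L\<close> and \<open>vs\<close>, but not on
  \<open>x\<close>; this is what allows a second, much larger box while \<open>L\<close> is kept
  fixed.\<close>

lemma avgs_close:
  assumes "L > 0" "\<And>x. integrable M (F x)" "\<And>x y. (\<integral>t. \<bar>F x t - F y t\<bar> \<partial>M) \<le> B (x - y)"
  shows "\<exists>R. \<forall>x. (\<integral>t. \<bar>avgs L vs (\<lambda>y. F y t) x - F x t\<bar> \<partial>M) \<le> R"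
  using assms(2,3)
proof (induction vs arbitrary: F)
  case Nil
  show ?case by (auto intro: exI [of _ 0])
next
  case (Cons v vs)
  let ?G = "\<lambda>x t. avg L v (\<lambda>y. F y t) x"
  have int: "integrable M (?G x)" for x
    using integrable_avg [of M F] Cons.prems by blast
  have "(\<integral>t. \<bar>?G x t - ?G y t\<bar> \<partial>M) \<le> B (x - y)" for x y
    using avgs_Lipschitz [OF assms(1), of M F B "[v]" x y] Cons.prems by simp
  then obtain R where R: "\<And>x. (\<integral>t. \<bar>avgs L vs (\<lambda>y. ?G y t) x - ?G x t\<bar> \<partial>M) \<le> R"
    using Cons.IH [of ?G] int by meson
  define S where "S = (\<Sum>k<L. \<bar>B (nmul k v)\<bar>)"
  have S: "(\<integral>t. \<bar>?G x t - F x t\<bar> \<partial>M) \<le> S" for x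
  proof -
    have "?G x t - F x t = avg L v (\<lambda>y. F y t - F x t) x" for t
      using assms(1) by (simp add: avg_diff avg_const)
    moreover have "(\<integral>t. \<bar>avg L v (\<lambda>y. F y t - F x t) x\<bar> \<partial>M) \<le> S"
    proof (rule L1_avg_le [OF assms(1)])
      fix k assume "k < L"
      have "(\<integral>t. \<bar>F (x + nmul k v) t - F x t\<bar> \<partial>M) \<le> B (nmul k v)"
        using Cons.prems(2) [of "x + nmul k v" x] by simp
      also have "\<dots> \<le> S"
        unfolding S_def using \<open>k < L\<close>
        by (intro order_trans [OF abs_ge_self member_le_sum [of k _ "\<lambda>k. \<bar>B (nmul k v)\<bar>"]]) auto
      finally show "(\<integral>t. \<bar>F (x + nmul k v) t - F x t\<bar> \<partial>M) \<le> S" .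
    qed (use Cons.prems in auto)
    ultimately show ?thesis by simp
  qed
  have "(\<integral>t. \<bar>avgs L (v # vs) (\<lambda>y. F y t) x - F x t\<bar> \<partial>M) \<le> R + S" for x
  proof -
    have "(\<integral>t. \<bar>(avgs L vs (\<lambda>y. ?G y t) x - ?G x t) + (?G x t - F x t)\<bar> \<partial>M) \<le> R + S"
      by (rule order_trans [OF L1_triangle add_mono [OF R S]])
        (use Cons.prems int in \<open>auto intro!: Bochner_Integration.integrable_diff integrable_avgs\<close>)
    then show ?thesis by simp
  qed
  then show ?case by blast
qed

text \<open>Averaging in direction \<open>b\<close> telescopes first differences in that direction to length \<open>L\<close>, divided
  by \<open>L\<close>; a further shift by \<open>w\<close> then costs only \<open>O(B w / L)\<close>.\<close>

lemma avgs_second_difference: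
  assumes "L > 0" "\<And>x. integrable M (F x)" "\<And>x y. (\<integral>t. \<bar>F x t - F y t\<bar> \<partial>M) \<le> B (x - y)"
    and "b \<in> set vs"
  defines "g \<equiv> \<lambda>x t. avgs L vs (\<lambda>y. F y t) x"
  shows "(\<integral>t. \<bar>(g (x + w + b) t - g (x + w) t) - (g (x + b) t - g x t)\<bar> \<partial>M) \<le> 2 * B w / L"
proof -
  let ?H = "\<lambda>t y. F (y + w) t - F y t"
  let ?K = "\<lambda>y t. ?H t (y + b) - ?H t y"
  have K: "(g (x + w + b) t - g (x + w) t) - (g (x + b) t - g x t) = avgs L vs (\<lambda>y. ?K y t) x" for t
  proof -
    have "avgs L vs (\<lambda>y. F (y + u) t) x = g (x + u) t" for u
      using fun_cong [OF avgs_shift [of L vs "\<lambda>y. F y t" u]] by (simp add: g_def)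
    from this [of b] this [of w] this [of "b + w"] show ?thesis
      by (simp add: avgs_diff add.assoc add.commute [of w b] g_def)
  qed
  have int: "integrable M (\<lambda>t. ?H t y)" for y
    using assms(2) by auto
  have H: "(\<integral>t. \<bar>?H t y\<bar> \<partial>M) \<le> B w" for y
    using assms(3) [of "y + w" y] by simp
  have "(\<integral>t. \<bar>avg L b (\<lambda>y. ?K y t) y\<bar> \<partial>M) \<le> 2 * B w / L" for y
  proof -
    have "(\<integral>t. \<bar>?H t (y + nmul L b) - ?H t y\<bar> \<partial>M) \<le> B w + B w"
      by (rule order_trans [OF L1_triangle_diff [OF int int] add_mono [OF H H]])
    moreover have "(\<integral>t. \<bar>avg L b (\<lambda>y. ?K y t) y\<bar> \<partial>M) = (\<integral>t. \<bar>?H t (y + nmul L b) - ?H t y\<bar> \<partial>M) / L"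
      using avg_telescope [of L b "?H _" y] by simp
    ultimately show ?thesis
      by (simp add: divide_right_mono)
  qed
  then show ?thesis
    unfolding K using assms(2) by (intro L1_avgs_le_mem [OF assms(1) _ assms(4)]) auto
qed

text \<open>An increment along \<open>sum b P\<close> splits into steps along single
  \<open>b p\<close>, and each is compared with the same step taken at \<open>x\<close>. The
  constant is quantified before \<open>g\<close>, \<open>c\<close> and \<open>x\<close>, so that it
  survives the limit in which \<open>c\<close> tends to 0.\<close>

lemma second_difference_sum:
  fixes b :: "'p \<Rightarrow> 'v::ab_group_add" and M :: "'a measure"
  assumes "finite P" "P \<subseteq> X"
  shows "\<exists>C. \<forall>g c x. (\<forall>x. integrable M (g x)) \<longrightarrow>
    (\<forall>p\<in>X. \<forall>x w. (\<integral>t. \<bar>(g (x + w + b p) t - g (x + w) t) - (g (x + b p) t - g x t)\<bar> \<partial>M) \<le> c * B w) \<longrightarrow>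
    (\<integral>t. \<bar>(g (x + w + sum b P) t - g (x + w) t) - (\<Sum>p\<in>P. g (x + b p) t - g x t)\<bar> \<partial>M) \<le> c * (C :: real)"
  using assms
proof (induction P arbitrary: w rule: finite_induct)
  case empty
  then show ?case by (auto intro: exI [of _ 0])
next
  case (insert p P)
  have "P \<subseteq> X"
    using insert.prems by simp
  \<comment> \<open>The step along \<open>b p\<close> is taken first, so the steps along
    \<open>P\<close> start at the larger shift \<open>w + b p\<close>.\<close>
  from insert.IH [OF this, of "w + b p"] obtain C where C: "\<forall>g c x. (\<forall>x. integrable M (g x)) \<longrightarrow>
    (\<forall>p\<in>X. \<forall>x w. (\<integral>t. \<bar>(g (x + w + b p) t - g (x + w) t) - (g (x + b p) t - g x t)\<bar> \<partial>M) \<le> c * B w) \<longrightarrow>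
    (\<integral>t. \<bar>(g (x + (w + b p) + sum b P) t - g (x + (w + b p)) t) - (\<Sum>p\<in>P. g (x + b p) t - g x t)\<bar> \<partial>M) \<le> c * C"
    by (rule exE)
  show ?case
  proof (intro exI [of _ "C + B w"] allI impI)
    fix g :: "'v \<Rightarrow> 'a \<Rightarrow> real" and c x
    assume int: "\<forall>x. integrable M (g x)" and
      S: "\<forall>p\<in>X. \<forall>x w. (\<integral>t. \<bar>(g (x + w + b p) t - g (x + w) t) - (g (x + b p) t - g x t)\<bar> \<partial>M) \<le> c * B w"
    let ?u = "\<lambda>t. (g (x + (w + b p) + sum b P) t - g (x + (w + b p)) t) - (\<Sum>p\<in>P. g (x + b p) t - g x t)"
    let ?v = "\<lambda>t. (g (x + w + b p) t - g (x + w) t) - (g (x + b p) t - g x t)"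
    have eq: "(g (x + w + sum b (insert p P)) t - g (x + w) t) - (\<Sum>p\<in>insert p P. g (x + b p) t - g x t)
      = ?u t + ?v t" for t
      using insert.hyps by (simp add: add_ac)
    have "(\<integral>t. \<bar>?u t + ?v t\<bar> \<partial>M) \<le> c * C + c * B w"
    proof (rule order_trans [OF L1_triangle add_mono])
      show "(\<integral>t. \<bar>?u t\<bar> \<partial>M) \<le> c * C"
        using C int S by blast
      show "(\<integral>t. \<bar>?v t\<bar> \<partial>M) \<le> c * B w"
        using S insert.prems by blast
    qed (use int in \<open>auto intro!: Bochner_Integration.integrable_diff Bochner_Integration.integrable_sum\<close>)
    then show "(\<integral>t. \<bar>(g (x + w + sum b (insert p P)) t - g (x + w) t) -
        (\<Sum>p\<in>insert p P. g (x + b p) t - g x t)\<bar> \<partial>M) \<le> c * (C + B w)"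
      unfolding eq by (simp add: distrib_left)
  qed
qed

section \<open>Linearization by averaging twice\<close>

lemma le_of_le_add_inverse:
  fixes a b c :: real
  assumes "\<And>k::nat. k > 0 \<Longrightarrow> a \<le> b + c / real k"
  shows "a \<le> b"
proof -
  have "(\<lambda>k. b + c / real k) \<longlonglongrightarrow> b + 0"
    by (intro tendsto_intros lim_const_over_n)
  moreover have "eventually (\<lambda>k. a \<le> b + c / real k) sequentially"
    using eventually_gt_at_top [of "0::nat"] by eventually_elim (use assms in auto)
  ultimately show ?thesis
    using tendsto_lowerbound [of _ "b + 0" sequentially a] by simp
qed

text \<open>For fixed \<open>x\<close> and \<open>t\<close> the hypothesis \<open>lin\<close> is applied to \<open>f p = g (x + b p) t - g x t\<close>, where \<open>g\<close> is the
  average of \<open>F\<close> over a box of side \<open>L\<close>. A second average, over \<open>x\<close> in a box of side \<open>K\<close> spanned by the tested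
  directions, telescopes to the lower bound \<open>low\<close>. Then \<open>K \<rightarrow> \<infinity>\<close> and \<open>L \<rightarrow> \<infinity>\<close>, in this order.\<close>

theorem linearization:
  fixes F :: "'v::ab_group_add \<Rightarrow> 'a \<Rightarrow> real" and b :: "'p \<Rightarrow> 'v" and \<alpha> lam :: "'i \<Rightarrow> real"
  assumes int: "\<And>x. integrable M (F x)"
    and Lip: "\<And>x y. (\<integral>t. \<bar>F x t - F y t\<bar> \<partial>M) \<le> B (x - y)"
    and fin: "finite I" "finite X"
    and PQ: "\<And>i. i \<in> I \<Longrightarrow> P i \<subseteq> X" "\<And>i. i \<in> I \<Longrightarrow> Q i \<subseteq> X"
    and \<alpha>: "\<And>i. i \<in> I \<Longrightarrow> \<alpha> i \<ge> 0"
    and lin: "\<And>f. (\<Sum>i\<in>I. \<alpha> i * \<bar>sum f (P i) - sum f (Q i)\<bar>) \<le> (\<Sum>(p, q)\<in>E. \<bar>f p - f q\<bar>)"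
    and low: "\<And>i K x. i \<in> I \<Longrightarrow>
      real K * lam i \<le> (\<integral>t. \<bar>F (x + nmul K (sum b (P i) - sum b (Q i))) t - F x t\<bar> \<partial>M)"
  shows "(\<Sum>i\<in>I. \<alpha> i * lam i) \<le> (\<Sum>(p, q)\<in>E. B (b p - b q))"
proof -
  obtain ps where ps: "set ps = X"
    using fin(2) finite_list by blast
  define v where "v = (\<lambda>i. sum b (P i) - sum b (Q i))"
  \<comment> \<open>\<open>C\<close> is chosen from this property before \<open>L\<close> and
    \<open>g\<close> are fixed, so \<open>S\<close> below is a constant and the error
    \<open>S / L\<close> vanishes in the limit.\<close>
  define bd where "bd = (\<lambda>S w C. \<forall>(g :: 'v \<Rightarrow> 'a \<Rightarrow> real) c x. (\<forall>x. integrable M (g x)) \<longrightarrow>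
    (\<forall>p\<in>X. \<forall>x w. (\<integral>t. \<bar>(g (x + w + b p) t - g (x + w) t) - (g (x + b p) t - g x t)\<bar> \<partial>M) \<le> c * B w) \<longrightarrow>
    (\<integral>t. \<bar>(g (x + w + sum b S) t - g (x + w) t) - (\<Sum>p\<in>S. g (x + b p) t - g x t)\<bar> \<partial>M) \<le> c * C)"
  have "\<exists>C. bd S w C" if "S \<subseteq> X" for S w
    unfolding bd_def by (rule second_difference_sum [OF finite_subset [OF that fin(2)] that])
  then obtain C where C: "\<And>S w. S \<subseteq> X \<Longrightarrow> bd S w (C S w)"
    by metis
  define R where "R = (\<Sum>(p, q)\<in>E. B (b p - b q))"
  define S where "S = (\<Sum>i\<in>I. \<alpha> i * (2 * (C (P i) (- sum b (Q i)) + C (Q i) (- sum b (Q i)))))"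
  have L_bound: "(\<Sum>i\<in>I. \<alpha> i * lam i) \<le> R + S / L" if L: "L > 0" for L :: nat
  proof -
    define g where "g = (\<lambda>x t. avgs L (map b ps) (\<lambda>y. F y t) x)"
    have gint: "integrable M (g x)" for x
      unfolding g_def using int integrable_avgs by blast
    have gLip: "(\<integral>t. \<bar>g x t - g y t\<bar> \<partial>M) \<le> B (x - y)" for x y
      unfolding g_def by (intro avgs_Lipschitz L int Lip)
    obtain R' where R': "\<And>x. (\<integral>t. \<bar>g x t - F x t\<bar> \<partial>M) \<le> R'"
      using avgs_close [OF L, of M F B "map b ps"] int Lip unfolding g_def by blast
    have g2: "(\<integral>t. \<bar>(g (x + w + b p) t - g (x + w) t) - (g (x + b p) t - g x t)\<bar> \<partial>M) \<le> (2 / L) * B w"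
      if "p \<in> X" for p x w
      using avgs_second_difference [OF L, of M F B "b p" "map b ps" x w] int Lip that ps
      unfolding g_def by simp
    define \<phi> where "\<phi> = (\<lambda>i x. \<integral>t. \<bar>g (x + v i) t - g x t\<bar> \<partial>M)"
    define f where "f = (\<lambda>x t p. g (x + b p) t - g x t)"
    have fint: "integrable M (\<lambda>t. f x t p)" for x p
      unfolding f_def using gint by auto
    have fsint: "integrable M (\<lambda>t. sum (f x t) T)" for x T
      using fint by auto
    have \<phi>_le: "\<phi> i x \<le> (\<integral>t. \<bar>sum (f x t) (P i) - sum (f x t) (Q i)\<bar> \<partial>M)
        + 2 / L * (C (P i) (- sum b (Q i)) + C (Q i) (- sum b (Q i)))" if i: "i \<in> I" for i x
    proof -
      \<comment> \<open>From \<open>?y\<close> the increment \<open>sum b (P i)\<close> leads to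
        \<open>x + v i\<close> and \<open>sum b (Q i)\<close> leads to \<open>x\<close>; their
        difference is the increment along \<open>v i\<close>, and only sums of the vectors
        \<open>b p\<close> are involved.\<close>
      let ?y = "x - sum b (Q i)"
      let ?e = "\<lambda>T t. (g (?y + sum b T) t - g ?y t) - sum (f x t) T"
      have e: "(\<integral>t. \<bar>?e T t\<bar> \<partial>M) \<le> 2 / L * C T (- sum b (Q i))" if "T \<subseteq> X" for T
      proof -
        have "(\<integral>t. \<bar>(g (x + - sum b (Q i) + sum b T) t - g (x + - sum b (Q i)) t)
            - (\<Sum>p\<in>T. g (x + b p) t - g x t)\<bar> \<partial>M) \<le> 2 / L * C T (- sum b (Q i))"
          using C [OF that, of "- sum b (Q i)", unfolded bd_def, rule_format, where g = g and c = "2 / L"]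
            gint g2 by blast
        then show ?thesis
          unfolding f_def by simp
      qed
      have eint: "integrable M (?e T)" for T
        using gint fsint by auto
      have "g (x + v i) t - g x t
          = (sum (f x t) (P i) - sum (f x t) (Q i)) + (?e (P i) t - ?e (Q i) t)" for t
        unfolding v_def by (simp add: algebra_simps)
      then have "\<phi> i x = (\<integral>t. \<bar>(sum (f x t) (P i) - sum (f x t) (Q i)) + (?e (P i) t - ?e (Q i) t)\<bar> \<partial>M)"
        unfolding \<phi>_def by simp
      also have "\<dots> \<le> (\<integral>t. \<bar>sum (f x t) (P i) - sum (f x t) (Q i)\<bar> \<partial>M) + (\<integral>t. \<bar>?e (P i) t - ?e (Q i) t\<bar> \<partial>M)"
        using gint fsint by (intro L1_triangle Bochner_Integration.integrable_diff)
      also have "(\<integral>t. \<bar>?e (P i) t - ?e (Q i) t\<bar> \<partial>M) \<le> (\<integral>t. \<bar>?e (P i) t\<bar> \<partial>M) + (\<integral>t. \<bar>?e (Q i) t\<bar> \<partial>M)"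
        by (rule L1_triangle_diff [OF eint eint])
      also have "\<dots> \<le> 2 / L * C (P i) (- sum b (Q i)) + 2 / L * C (Q i) (- sum b (Q i))"
        by (intro add_mono e PQ i)
      finally show ?thesis
        by (simp add: distrib_left)
    qed
    have upper: "(\<Sum>i\<in>I. \<alpha> i * \<phi> i x) \<le> R + S / L" for x
    proof -
      have "(\<Sum>i\<in>I. \<alpha> i * (\<integral>t. \<bar>sum (f x t) (P i) - sum (f x t) (Q i)\<bar> \<partial>M))
        = (\<integral>t. (\<Sum>i\<in>I. \<alpha> i * \<bar>sum (f x t) (P i) - sum (f x t) (Q i)\<bar>) \<partial>M)"
        using fsint by (subst Bochner_Integration.integral_sum) auto
      also have "\<dots> \<le> (\<integral>t. (\<Sum>(p, q)\<in>E. \<bar>f x t p - f x t q\<bar>) \<partial>M)"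
        using fsint fint by (intro integral_mono lin) (auto simp: case_prod_beta)
      also have "\<dots> = (\<Sum>(p, q)\<in>E. \<integral>t. \<bar>f x t p - f x t q\<bar> \<partial>M)"
        using fint by (subst Bochner_Integration.integral_sum) (auto simp: case_prod_beta)
      also have "\<dots> \<le> R"
        unfolding R_def f_def using gLip [of "x + b p" "x + b q" for p q]
        by (intro sum_mono) (simp add: case_prod_beta)
      finally have 1: "(\<Sum>i\<in>I. \<alpha> i * (\<integral>t. \<bar>sum (f x t) (P i) - sum (f x t) (Q i)\<bar> \<partial>M)) \<le> R" .
      have "(\<Sum>i\<in>I. \<alpha> i * \<phi> i x) \<le> (\<Sum>i\<in>I. \<alpha> i * ((\<integral>t. \<bar>sum (f x t) (P i) - sum (f x t) (Q i)\<bar> \<partial>M)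
        + 2 / L * (C (P i) (- sum b (Q i)) + C (Q i) (- sum b (Q i)))))"
        by (intro sum_mono mult_left_mono \<phi>_le \<alpha>)
      also have "\<dots> = (\<Sum>i\<in>I. \<alpha> i * (\<integral>t. \<bar>sum (f x t) (P i) - sum (f x t) (Q i)\<bar> \<partial>M)) + S / L"
        unfolding S_def sum_divide_distrib sum.distrib [symmetric]
        by (intro sum.cong refl) (simp add: algebra_simps add_divide_distrib)
      finally show ?thesis
        using 1 by simp
    qed
    have "(\<Sum>i\<in>I. \<alpha> i * lam i) \<le> (R + S / L) + (\<Sum>i\<in>I. \<alpha> i * (2 * R')) / K" if K: "K > 0" for K :: nat
    proof -
      obtain js where js: "set js = I"
        using fin(1) finite_list by blast
      let ?A = "avgs K (map v js)"
      have low_avg: "lam i - 2 * R' / K \<le> avg K (v i) (\<phi> i) x" if i: "i \<in> I" for i x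
      proof -
        let ?x' = "x + nmul K (v i)"
        have "real K * lam i \<le> (\<integral>t. \<bar>F ?x' t - F x t\<bar> \<partial>M)"
          using low [OF i, of K x] unfolding v_def .
        also have "\<dots> = (\<integral>t. \<bar>(g ?x' t - g x t) + ((g x t - F x t) - (g ?x' t - F ?x' t))\<bar> \<partial>M)"
          by simp
        also have "\<dots> \<le> (\<integral>t. \<bar>g ?x' t - g x t\<bar> \<partial>M) + (\<integral>t. \<bar>(g x t - F x t) - (g ?x' t - F ?x' t)\<bar> \<partial>M)"
          using gint int by (intro L1_triangle Bochner_Integration.integrable_diff)
        also have "(\<integral>t. \<bar>(g x t - F x t) - (g ?x' t - F ?x' t)\<bar> \<partial>M)
            \<le> (\<integral>t. \<bar>g x t - F x t\<bar> \<partial>M) + (\<integral>t. \<bar>g ?x' t - F ?x' t\<bar> \<partial>M)"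
          using gint int by (intro L1_triangle_diff Bochner_Integration.integrable_diff)
        also have "\<dots> \<le> R' + R'"
          by (intro add_mono R')
        also have "(\<integral>t. \<bar>g ?x' t - g x t\<bar> \<partial>M)
            = (\<integral>t. \<bar>\<Sum>k<K. g (x + nmul k (v i) + v i) t - g (x + nmul k (v i)) t\<bar> \<partial>M)"
          using sum_lessThan_telescope [of "\<lambda>k. g (x + nmul k (v i)) _" K] by (simp add: add.assoc)
        also have "\<dots> \<le> (\<Sum>k<K. \<phi> i (x + nmul k (v i)))"
          unfolding \<phi>_def using gint by (intro L1_triangle_sum Bochner_Integration.integrable_diff)
        also have "\<dots> = K * avg K (v i) (\<phi> i) x"
          using K by (simp add: avg_def)
        finally have "real K * lam i \<le> K * avg K (v i) (\<phi> i) x + (R' + R')"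
          by simp
        then show ?thesis
          using K by (simp add: field_simps)
      qed
      \<comment> \<open>One box serves all \<open>i\<close>: each term is bounded below through its
        own direction \<open>v i\<close>, while the whole sum is bounded above at every
        point.\<close>
      have "(\<Sum>i\<in>I. \<alpha> i * (lam i - 2 * R' / K)) \<le> (\<Sum>i\<in>I. \<alpha> i * ?A (\<phi> i) 0)"
        using js low_avg by (intro sum_mono mult_left_mono \<alpha> avgs_ge_mem [OF K]) auto
      also have "\<dots> = ?A (\<lambda>x. \<Sum>i\<in>I. \<alpha> i * \<phi> i x) 0"
        by (simp add: avgs_lincomb)
      also have "\<dots> \<le> R + S / L"
        by (intro avgs_le K upper)
      finally show ?thesis
        by (simp add: right_diff_distrib sum_subtractf sum_divide_distrib)
    qed
    then show ?thesis
      by (rule le_of_le_add_inverse)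
  qed
  then have "(\<Sum>i\<in>I. \<alpha> i * lam i) \<le> R"
    by (rule le_of_le_add_inverse)
  then show ?thesis
    unfolding R_def .
qed

subsection \<open>The transportation norm\<close>

lemma tc_norm_le_point_masses:
  assumes "p \<in> X" "q \<in> X" "\<And>x y. x \<in> X \<Longrightarrow> y \<in> X \<Longrightarrow> d x y \<ge> 0"
  shows "tc_norm X d (\<lambda>z. (if z = p then 1 else 0) - (if z = q then 1 else 0)) \<le> d p q"
  unfolding tc_norm_def
proof (rule cInf_lower, goal_cases)
  case 1
  show ?case
    using assms by (intro CollectI exI [of _ 1] exI [of _ "\<lambda>_. 1"] exI [of _ "\<lambda>_. p"] exI [of _ "\<lambda>_. q"]) auto
next
  case 2
  show ?case
    by (rule bdd_belowI [of _ 0]) (auto intro!: sum_nonneg mult_nonneg_nonneg assms(3))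
qed

text \<open>The infimum can be bounded below only over a nonempty set. Here every mass is moved to
  or from a fixed point \<open>z\<close>, the orientation absorbing its sign; what accumulates at
  \<open>z\<close> is the total mass 0.\<close>

lemma tc_norm_nonempty:
  assumes "finite X" "\<mu> \<in> TC X"
  shows "\<exists>k a x y. (\<forall>i<k. a i \<ge> 0 \<and> x i \<in> X \<and> y i \<in> X) \<and>
    (\<forall>p. \<mu> p = (\<Sum>i<(k::nat). a i * ((if p = x i then 1 else 0) - (if p = y i then 1 else 0)) :: real))"
proof (cases "X = {}")
  case True
  then show ?thesis
    using assms by (intro exI [of _ 0]) (auto simp: TC_def)
next
  case False
  then obtain z where z: "z \<in> X" by blast
  obtain h where h: "bij_betw h {..<card X} X"
    using ex_bij_betw_nat_finite [OF assms(1)] by (auto simp: atLeast0LessThan)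
  define x where "x = (\<lambda>i. if \<mu> (h i) \<ge> 0 then h i else z)"
  define y where "y = (\<lambda>i. if \<mu> (h i) \<ge> 0 then z else h i)"
  have hX: "h i \<in> X" if "i < card X" for i
    using h that by (auto simp: bij_betw_def)
  have \<mu>: "\<And>p. p \<notin> X \<Longrightarrow> \<mu> p = 0" "sum \<mu> X = 0"
    using assms(2) by (auto simp: TC_def)
  have "(\<Sum>i<card X. \<bar>\<mu> (h i)\<bar> * ((if p = x i then 1 else 0) - (if p = y i then 1 else 0))) = \<mu> p" for p
  proof -
    have "(\<Sum>i<card X. \<bar>\<mu> (h i)\<bar> * ((if p = x i then 1 else 0) - (if p = y i then 1 else 0)))
      = (\<Sum>i<card X. \<mu> (h i) * ((if p = h i then 1 else 0) - (if p = z then 1 else 0)))"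
      by (intro sum.cong refl) (auto simp: x_def y_def)
    also have "\<dots> = (\<Sum>q\<in>X. \<mu> q * ((if p = q then 1 else 0) - (if p = z then 1 else 0)))"
      by (rule sum.reindex_bij_betw [OF h])
    also have "\<dots> = (\<Sum>q\<in>X. if p = q then \<mu> q else 0) - (\<Sum>q\<in>X. \<mu> q * (if p = z then 1 else 0))"
      by (subst sum_subtractf [symmetric]) (auto intro!: sum.cong simp: algebra_simps)
    also have "\<dots> = \<mu> p"
      using \<mu> assms(1) by (simp add: sum_distrib_right [symmetric])
    finally show ?thesis .
  qed
  then show ?thesis
    using hX z by (intro exI [of _ "card X"] exI [of _ "\<lambda>i. \<bar>\<mu> (h i)\<bar>"] exI [of _ x] exI [of _ y])
      (auto simp: x_def y_def)
qed

text \<open>The easy half of Kantorovich duality: the pairing is estimated on each representation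
  term by term.\<close>

lemma tc_norm_ge_Lipschitz:
  assumes "finite X" "\<mu> \<in> TC X"
    and Lip: "\<And>p q. p \<in> X \<Longrightarrow> q \<in> X \<Longrightarrow> \<phi> p - \<phi> q \<le> d p q"
  shows "(\<Sum>p\<in>X. \<phi> p * \<mu> p) \<le> tc_norm X d \<mu>"
  unfolding tc_norm_def
proof (rule cInf_greatest, goal_cases)
  case 1
  show ?case
    using tc_norm_nonempty [OF assms(1,2)] by blast
next
  case (2 v)
  then obtain k :: nat and a x y where v: "v = (\<Sum>i<k. a i * d (x i) (y i))"
    and X: "\<forall>i<k. a i \<ge> 0 \<and> x i \<in> X \<and> y i \<in> X"
    and \<mu>: "\<forall>p. \<mu> p = (\<Sum>i<k. a i * ((if p = x i then 1 else 0) - (if p = y i then 1 else 0)))"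
    by blast
  have "(\<Sum>p\<in>X. \<phi> p * \<mu> p) = (\<Sum>i<k. \<Sum>p\<in>X. a i * ((if p = x i then \<phi> p else 0) - (if p = y i then \<phi> p else 0)))"
    unfolding \<mu> [rule_format] sum_distrib_left
    by (subst sum.swap) (auto intro!: sum.cong)
  also have "\<dots> = (\<Sum>i<k. a i * (\<phi> (x i) - \<phi> (y i)))"
    using X assms(1) by (intro sum.cong refl) (simp add: sum_distrib_left [symmetric] sum_subtractf)
  also have "\<dots> \<le> v"
    unfolding v using X by (intro sum_mono mult_left_mono Lip) auto
  finally show ?case .
qed

section \<open>Lipschitz functions on the integer grid\<close>

lemma int_Lipschitz_of_steps:
  fixes f :: "int \<Rightarrow> real"
  assumes "\<And>x. \<bar>f (x + 1) - f x\<bar> \<le> 1"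
  shows "\<bar>f x - f y\<bar> \<le> of_int \<bar>x - y\<bar>"
proof -
  have *: "\<bar>f (y + int k) - f y\<bar> \<le> k" for k y
  proof (induction k)
    case (Suc k)
    then show ?case
      using assms [of "y + int k"] by (simp add: add_ac)
  qed simp
  show ?thesis
    using * [of y "nat (x - y)"] * [of x "nat (y - x)"] by (cases "x \<ge> y") auto
qed

lemma l1dist_Lipschitz_of_steps:
  assumes "\<And>x y. \<bar>f (x + 1, y) - f (x, y)\<bar> \<le> 1" "\<And>x y. \<bar>f (x, y + 1) - f (x, y)\<bar> \<le> 1"
  shows "\<bar>f p - f q\<bar> \<le> l1dist p q"
  using int_Lipschitz_of_steps [of "\<lambda>x. f (x, snd p)" "fst p" "fst q"]
    int_Lipschitz_of_steps [of "\<lambda>y. f (fst q, y)" "snd p" "snd q"] assms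
  by (simp add: l1dist_def)

subsection \<open>Total variation on a square grid\<close>

definition square :: "nat \<Rightarrow> (nat \<times> nat) set" where
  "square N = {..<N} \<times> {..<N}"

text \<open>Each point of \<open>square N\<close> owns the edges to its right and upper neighbours,
  so endpoints reach coordinate \<open>N\<close>.\<close>

definition edges :: "nat \<Rightarrow> ((nat \<times> nat) \<times> (nat \<times> nat)) set" where
  "edges N = (\<lambda>(x, y). ((Suc x, y), (x, y))) ` square N \<union> (\<lambda>(x, y). ((x, Suc y), (x, y))) ` square N"

definition TV :: "nat \<Rightarrow> (nat \<times> nat \<Rightarrow> real) \<Rightarrow> real" where
  "TV N f = (\<Sum>(p, q)\<in>edges N. \<bar>f p - f q\<bar>)"

lemma finite_square [simp]: "finite (square N)"
  by (simp add: square_def)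

lemma card_edges_le: "card (edges N) \<le> 2 * N^2"
proof -
  have "card (edges N) \<le> card (square N) + card (square N)"
    unfolding edges_def by (intro order_trans [OF card_Un_le] add_mono card_image_le) auto
  then show ?thesis
    by (simp add: square_def power2_eq_square)
qed

lemma TV_nonneg: "0 \<le> TV N f"
  unfolding TV_def by (auto intro: sum_nonneg)

lemma TV_eq:
  "TV N f = (\<Sum>y<N. \<Sum>x<N. \<bar>f (Suc x, y) - f (x, y)\<bar>) + (\<Sum>x<N. \<Sum>y<N. \<bar>f (x, Suc y) - f (x, y)\<bar>)"
proof -
  have "TV N f = (\<Sum>(p, q)\<in>(\<lambda>(x, y). ((Suc x, y), (x, y))) ` square N. \<bar>f p - f q\<bar>)
      + (\<Sum>(p, q)\<in>(\<lambda>(x, y). ((x, Suc y), (x, y))) ` square N. \<bar>f p - f q\<bar>)"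
    unfolding TV_def edges_def by (rule sum.union_disjoint) auto
  also have "\<dots> = (\<Sum>(x, y)\<in>square N. \<bar>f (Suc x, y) - f (x, y)\<bar>) + (\<Sum>(x, y)\<in>square N. \<bar>f (x, Suc y) - f (x, y)\<bar>)"
  proof -
    have 1: "inj_on (\<lambda>(x, y). ((Suc x, y), (x, y))) (square N)"
      and 2: "inj_on (\<lambda>(x, y). ((x, Suc y), (x, y))) (square N)"
      by (auto intro: inj_onI)
    show ?thesis
      unfolding sum.reindex [OF 1] sum.reindex [OF 2] by (simp add: case_prod_beta)
  qed
  also have "(\<Sum>(x, y)\<in>square N. \<bar>f (Suc x, y) - f (x, y)\<bar>) = (\<Sum>y<N. \<Sum>x<N. \<bar>f (Suc x, y) - f (x, y)\<bar>)"
    unfolding square_def by (subst sum.swap) (simp add: sum.cartesian_product)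
  finally show ?thesis
    by (simp add: square_def sum.cartesian_product)
qed

subsection \<open>Isoperimetry in a square\<close>

lemma abs_diff_le_variation:
  fixes h :: "nat \<Rightarrow> real"
  assumes "a < N" "b < N"
  shows "\<bar>h a - h b\<bar> \<le> (\<Sum>i<N. \<bar>h (Suc i) - h i\<bar>)"
proof -
  have *: "\<bar>h b - h a\<bar> \<le> (\<Sum>i<N. \<bar>h (Suc i) - h i\<bar>)" if "a \<le> b" "b < N" for a b
  proof -
    have "\<bar>h b - h a\<bar> = \<bar>\<Sum>i=a..<b. h (Suc i) - h i\<bar>"
      using that by (simp add: sum_Suc_diff')
    also have "\<dots> \<le> (\<Sum>i=a..<b. \<bar>h (Suc i) - h i\<bar>)"
      by (rule sum_abs)
    also have "\<dots> \<le> (\<Sum>i<N. \<bar>h (Suc i) - h i\<bar>)"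
      using that by (intro sum_mono2) auto
    finally show ?thesis .
  qed
  show ?thesis
    using * [of a b] * [of b a] assms by (cases "a \<le> b") (auto simp: abs_minus_commute)
qed

text \<open>The set of mixed rows and the set of mixed columns each have at most perimeter many elements,
  and one of \<open>A\<close> and its complement lies in the product of the two, unless all rows or all columns are mixed.\<close>

lemma square_isoperimetric:
  fixes A :: "(nat \<times> nat) set" and N :: nat
  defines "P \<equiv> TV N (indicator A)"
  shows "real (card (square N \<inter> A)) \<le> P\<^sup>2 \<or> real (card (square N - A)) \<le> P\<^sup>2"
proof -
  define R where "R = {y\<in>{..<N}. \<exists>x<N. \<exists>x'<N. (x, y) \<in> A \<and> (x', y) \<notin> A}"
  define C where "C = {x\<in>{..<N}. \<exists>y<N. \<exists>y'<N. (x, y) \<in> A \<and> (x, y') \<notin> A}"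
  let ?f = "indicator A :: nat \<times> nat \<Rightarrow> real"
  have fin: "finite R" "finite C"
    by (auto simp: R_def C_def)
  have row: "1 \<le> (\<Sum>x<N. \<bar>?f (Suc x, y) - ?f (x, y)\<bar>)" if y: "y \<in> R" for y
  proof -
    obtain x x' where "x < N" "x' < N" "(x, y) \<in> A" "(x', y) \<notin> A"
      using y unfolding R_def by blast
    then show ?thesis
      using abs_diff_le_variation [of x N x' "\<lambda>x. ?f (x, y)"] by simp
  qed
  have col: "1 \<le> (\<Sum>y<N. \<bar>?f (x, Suc y) - ?f (x, y)\<bar>)" if x: "x \<in> C" for x
  proof -
    obtain y y' where "y < N" "y' < N" "(x, y) \<in> A" "(x, y') \<notin> A"
      using x unfolding C_def by blast
    then show ?thesis
      using abs_diff_le_variation [of y N y' "\<lambda>y. ?f (x, y)"] by simp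
  qed
  have "real (card R) = (\<Sum>y\<in>R. 1)"
    by simp
  also have "\<dots> \<le> (\<Sum>y\<in>R. \<Sum>x<N. \<bar>?f (Suc x, y) - ?f (x, y)\<bar>)"
    by (intro sum_mono row)
  also have "\<dots> \<le> (\<Sum>y<N. \<Sum>x<N. \<bar>?f (Suc x, y) - ?f (x, y)\<bar>)"
    by (intro sum_mono2) (auto simp: R_def intro: sum_nonneg)
  also have "\<dots> \<le> P"
    unfolding P_def TV_eq by (simp add: sum_nonneg)
  finally have RP: "real (card R) \<le> P" .
  have "real (card C) = (\<Sum>x\<in>C. 1)"
    by simp
  also have "\<dots> \<le> (\<Sum>x\<in>C. \<Sum>y<N. \<bar>?f (x, Suc y) - ?f (x, y)\<bar>)"
    by (intro sum_mono col)
  also have "\<dots> \<le> (\<Sum>x<N. \<Sum>y<N. \<bar>?f (x, Suc y) - ?f (x, y)\<bar>)"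
    by (intro sum_mono2) (auto simp: C_def intro: sum_nonneg)
  also have "\<dots> \<le> P"
    unfolding P_def TV_eq by (simp add: sum_nonneg)
  finally have CP: "real (card C) \<le> P" .
  have small: "real (card S) \<le> P\<^sup>2" if "S \<subseteq> C \<times> R" for S
  proof -
    have "card S \<le> card (C \<times> R)"
      using card_mono [OF _ that] fin by blast
    then have "real (card S) \<le> real (card (C \<times> R))"
      by (rule of_nat_mono)
    also have "\<dots> = real (card C) * real (card R)"
      by (simp add: card_cartesian_product)
    also have "\<dots> \<le> P * P"
      using CP RP by (intro mult_mono) auto
    finally show ?thesis
      by (simp add: power2_eq_square)
  qed
  show ?thesis
  proof (cases "R = {..<N} \<or> C = {..<N}")
    case True
    \<comment> \<open>If all rows or all columns are mixed, \<open>P\<close> is at least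
      \<open>N\<close>, and its square bounds the area of the whole square.\<close>
    then have "real N \<le> P"
      using RP CP by auto
    then have "real N * real N \<le> P * P"
      by (intro mult_mono) auto
    moreover have "card (square N \<inter> A) \<le> N * N"
      using card_mono [of "square N" "square N \<inter> A"] by (simp add: square_def)
    ultimately have "real (card (square N \<inter> A)) \<le> P\<^sup>2"
      unfolding power2_eq_square by (metis of_nat_mono of_nat_mult order_trans)
    then show ?thesis ..
  next
    case False
    \<comment> \<open>An unmixed column and an unmixed row cross at \<open>(x0, y0)\<close> and lie
      on the same side as that point. A point on the other side has both its row and its column
      mixed, as they meet this cross.\<close>
    then obtain x0 y0 where "x0 < N" "x0 \<notin> C" "y0 < N" "y0 \<notin> R"
      unfolding R_def C_def by blast
    then have rows: "(x, y0) \<in> A \<longleftrightarrow> (x', y0) \<in> A" and cols: "(x0, y) \<in> A \<longleftrightarrow> (x0, y') \<in> A"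
      if "x < N" "x' < N" "y < N" "y' < N" for x x' y y'
      using that unfolding R_def C_def by blast+
    show ?thesis
    proof (cases "(x0, y0) \<in> A")
      case True
      have "square N - A \<subseteq> C \<times> R"
        using rows [of x0] cols [of _ _ y0] True \<open>x0 < N\<close> \<open>y0 < N\<close>
        unfolding square_def R_def C_def by blast
      then show ?thesis
        using small by blast
    next
      case False
      have "square N \<inter> A \<subseteq> C \<times> R"
        using rows [of x0] cols [of _ _ y0] False \<open>x0 < N\<close> \<open>y0 < N\<close>
        unfolding square_def R_def C_def by blast
      then show ?thesis
        using small by blast
    qed
  qed
qed

subsection \<open>Reduction to indicator functions\<close>

text \<open>Discrete coarea formula by induction on the number of values: peeling off the top level,
  the left side is subadditive and the right side exactly additive. For constant functions the left
  side vanishes because \<open>P i\<close> and \<open>Q i\<close> have equally many points.\<close>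

lemma coarea_reduction:
  fixes \<alpha> :: "'i \<Rightarrow> real" and f :: "'p \<Rightarrow> real"
  assumes "finite X" "\<And>i. i \<in> I \<Longrightarrow> \<alpha> i \<ge> 0"
    and PQ: "\<And>i. i \<in> I \<Longrightarrow> P i \<subseteq> X" "\<And>i. i \<in> I \<Longrightarrow> Q i \<subseteq> X" "\<And>i. i \<in> I \<Longrightarrow> card (P i) = card (Q i)"
    and E: "E \<subseteq> X \<times> X"
    and ind: "\<And>A. (\<Sum>i\<in>I. \<alpha> i * \<bar>sum (indicator A) (P i) - sum (indicator A) (Q i)\<bar>)
      \<le> (\<Sum>(p, q)\<in>E. \<bar>indicator A p - indicator A q :: real\<bar>)"
  shows "(\<Sum>i\<in>I. \<alpha> i * \<bar>sum f (P i) - sum f (Q i)\<bar>) \<le> (\<Sum>(p, q)\<in>E. \<bar>f p - f q\<bar>)"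
proof (induction "card (f ` X)" arbitrary: f rule: less_induct)
  case less
  have nonneg: "0 \<le> (\<Sum>(p, q)\<in>E. \<bar>f p - f q\<bar>)"
    by (auto intro: sum_nonneg)
  show ?case
  proof (cases "\<exists>c. \<forall>p\<in>X. f p = c")
    case True
    then obtain c where c: "\<And>p. p \<in> X \<Longrightarrow> f p = c" by blast
    have "\<bar>sum f (P i) - sum f (Q i)\<bar> = 0" if "i \<in> I" for i
    proof -
      have "sum f (P i) = (\<Sum>_\<in>P i. c)" "sum f (Q i) = (\<Sum>_\<in>Q i. c)"
        using PQ(1,2) [OF that] c by (auto simp del: sum_constant intro!: sum.cong)
      then show ?thesis
        using PQ(3) [OF that] by simp
    qed
    then show ?thesis
      using nonneg by simp
  next
    case False
    \<comment> \<open>\<open>m\<close> and \<open>m'\<close> are the two largest values; truncating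
      \<open>f\<close> at \<open>m'\<close> merges them and leaves one value fewer.\<close>
    define m where "m = Max (f ` X)"
    define m' where "m' = Max (f ` X - {m})"
    have X: "X \<noteq> {}"
      using False by blast
    have m_in: "m \<in> f ` X"
      unfolding m_def using X assms(1) by (intro Max_in) auto
    have "f ` X - {m} \<noteq> {}"
      using False by blast
    then have m'_in: "m' \<in> f ` X - {m}"
      unfolding m'_def using assms(1) by (intro Max_in) auto
    have le_m: "f p \<le> m" if "p \<in> X" for p
      unfolding m_def using that assms(1) by simp
    have le_m': "f p \<le> m'" if "p \<in> X" "f p \<noteq> m" for p
      unfolding m'_def using that assms(1) by (intro Max_ge) auto
    have lt: "m' < m"
      using m'_in le_m by force
    define A where "A = {p\<in>X. f p = m}"
    define g where "g = (\<lambda>p. min (f p) m')"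
    have fg: "f p = g p + (m - m') * indicator A p" if "p \<in> X" for p
      using that le_m' [of p] lt by (auto simp: g_def A_def indicator_def)
    have "g ` X \<subseteq> f ` X - {m}"
      using m'_in lt by (auto simp: g_def min_def)
    then have "card (g ` X) \<le> card (f ` X - {m})"
      using assms(1) by (intro card_mono) auto
    also have "\<dots> < card (f ` X)"
      using m_in assms(1) by (intro psubset_card_mono) auto
    finally have IH: "(\<Sum>i\<in>I. \<alpha> i * \<bar>sum g (P i) - sum g (Q i)\<bar>) \<le> (\<Sum>(p, q)\<in>E. \<bar>g p - g q\<bar>)"
      by (rule less)
    have "(\<Sum>i\<in>I. \<alpha> i * \<bar>sum f (P i) - sum f (Q i)\<bar>)
      \<le> (\<Sum>i\<in>I. \<alpha> i * (\<bar>sum g (P i) - sum g (Q i)\<bar>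
        + (m - m') * \<bar>sum (indicator A) (P i) - sum (indicator A) (Q i)\<bar>))"
    proof (intro sum_mono mult_left_mono assms(2))
      fix i assume i: "i \<in> I"
      have "sum f S = sum g S + (m - m') * sum (indicator A) S" if "S \<subseteq> X" for S
        using that fg by (simp add: sum_distrib_left sum.distrib [symmetric] subset_iff)
      then have "sum f (P i) - sum f (Q i) = (sum g (P i) - sum g (Q i))
          + (m - m') * (sum (indicator A) (P i) - sum (indicator A) (Q i))"
        using PQ(1,2) [OF i] by (simp add: right_diff_distrib)
      also have "\<bar>\<dots>\<bar> \<le> \<bar>sum g (P i) - sum g (Q i)\<bar>
          + \<bar>(m - m') * (sum (indicator A) (P i) - sum (indicator A) (Q i))\<bar>"
        by (rule abs_triangle_ineq)
      finally show "\<bar>sum f (P i) - sum f (Q i)\<bar> \<le> \<bar>sum g (P i) - sum g (Q i)\<bar>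
          + (m - m') * \<bar>sum (indicator A) (P i) - sum (indicator A) (Q i)\<bar>"
        using lt by (simp add: abs_mult)
    qed
    also have "\<dots> = (\<Sum>i\<in>I. \<alpha> i * \<bar>sum g (P i) - sum g (Q i)\<bar>)
        + (m - m') * (\<Sum>i\<in>I. \<alpha> i * \<bar>sum (indicator A) (P i) - sum (indicator A) (Q i)\<bar>)"
      by (simp add: sum_distrib_left sum.distrib [symmetric] algebra_simps)
    also have "\<dots> \<le> (\<Sum>(p, q)\<in>E. \<bar>g p - g q\<bar>) + (m - m') * (\<Sum>(p, q)\<in>E. \<bar>indicator A p - indicator A q\<bar>)"
      using lt by (intro add_mono IH mult_left_mono ind) auto
    also have "\<dots> = (\<Sum>(p, q)\<in>E. \<bar>g p - g q\<bar> + (m - m') * \<bar>indicator A p - indicator A q\<bar>)"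
      by (simp add: sum_distrib_left sum.distrib [symmetric] case_prod_beta)
    also have "\<dots> = (\<Sum>(p, q)\<in>E. \<bar>f p - f q\<bar>)"
    \<comment> \<open>\<open>g\<close> and the indicator of \<open>A\<close> both increase with
      \<open>f\<close>, so their differences along an edge never have opposite signs and the
      absolute values add.\<close>
    proof (intro sum.cong refl, clarify)
      fix p q assume "(p, q) \<in> E"
      then have "p \<in> X" "q \<in> X"
        using E by auto
      then show "\<bar>g p - g q\<bar> + (m - m') * \<bar>indicator A p - indicator A q\<bar> = \<bar>f p - f q\<bar>"
        using le_m' [of p] le_m' [of q] lt by (auto simp: g_def A_def indicator_def)
    qed
    finally show ?thesis .
  qed
qed

subsection \<open>Random signs\<close>

lemma sum_Pow_insert:
  assumes "finite C" "c \<notin> C"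
  shows "(\<Sum>S\<in>Pow (insert c C). g S) = (\<Sum>S\<in>Pow C. g S + g (insert c S))"
proof -
  have "inj_on (insert c) (Pow C)"
    using assms(2) by (auto intro!: inj_onI)
  then show ?thesis
    unfolding Pow_insert sum.distrib using assms
    by (subst sum.union_disjoint) (auto simp: sum.reindex)
qed

text \<open>\<open>S\<close> is the set of indices with sign \<open>+1\<close>. Summing over the two
  signs of one index cancels the cross term.\<close>

lemma random_signs_second_moment:
  fixes a :: "'c \<Rightarrow> real"
  assumes "finite C"
  shows "(\<Sum>S\<in>Pow C. (\<Sum>c\<in>C. (if c \<in> S then 1 else - 1) * a c)\<^sup>2) = 2 ^ card C * (\<Sum>c\<in>C. (a c)\<^sup>2)"
  using assms
proof (induction C rule: finite_induct)
  case (insert c C)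
  let ?t = "\<lambda>S. \<Sum>c\<in>C. (if c \<in> S then 1 else - 1) * a c"
  have t: "?t (insert c S) = ?t S" for S
    using insert.hyps by (intro sum.cong) auto
  have "(\<Sum>S\<in>Pow (insert c C). (\<Sum>c\<in>insert c C. (if c \<in> S then 1 else - 1) * a c)\<^sup>2)
    = (\<Sum>S\<in>Pow C. (- a c + ?t S)\<^sup>2 + (a c + ?t S)\<^sup>2)"
    unfolding sum_Pow_insert [OF insert.hyps] using insert.hyps t by (intro sum.cong refl) auto
  also have "\<dots> = (\<Sum>S\<in>Pow C. 2 * (a c)\<^sup>2 + 2 * (?t S)\<^sup>2)"
    by (intro sum.cong refl) (simp add: power2_eq_square algebra_simps)
  also have "\<dots> = 2 ^ card C * 2 * (a c)\<^sup>2 + 2 * (\<Sum>S\<in>Pow C. (?t S)\<^sup>2)"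
    using insert.hyps by (simp add: sum.distrib card_Pow sum_distrib_left)
  finally show ?case
    using insert by (simp add: algebra_simps)
qed simp

text \<open>Cauchy-Schwarz over all sign patterns, the elementary direction of Khintchine's
  inequality.\<close>

lemma random_signs_first_moment:
  fixes a :: "'c \<Rightarrow> real"
  assumes "finite C"
  shows "(\<Sum>S\<in>Pow C. \<bar>\<Sum>c\<in>C. (if c \<in> S then 1 else - 1) * a c\<bar>) \<le> 2 ^ card C * sqrt (\<Sum>c\<in>C. (a c)\<^sup>2)"
proof -
  let ?t = "\<lambda>S. \<bar>\<Sum>c\<in>C. (if c \<in> S then 1 else - 1) * a c\<bar>"
  have "(\<Sum>S\<in>Pow C. ?t S)\<^sup>2 \<le> (\<Sum>S\<in>Pow C. (?t S)\<^sup>2) * card (Pow C)"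
    by (rule sum_squared_le_sum_of_squares)
  also have "\<dots> = (2 ^ card C * sqrt (\<Sum>c\<in>C. (a c)\<^sup>2))\<^sup>2"
    using random_signs_second_moment [OF assms, of a] assms
    by (simp add: card_Pow power_mult_distrib sum_nonneg power2_eq_square)
  finally show ?thesis
    by (rule power2_le_imp_le) (simp add: sum_nonneg)
qed

subsection \<open>Summation over scales\<close>

text \<open>A geometric series of ratio \<open>sqrt 2\<close>. The factor 5/2 rounds up
  \<open>1 / (sqrt 2 - 1)\<close>; the induction closes because 5/2 + 1 = 5/2 * 7/5 and 7/5 is below
  \<open>sqrt 2\<close>.\<close>

lemma sum_sqrt_power2_le:
  assumes "P \<ge> 0"
  shows "(\<Sum>j<m. sqrt (2 ^ j * P)) \<le> 5 / 2 * sqrt (2 ^ m * P)"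
proof (induction m)
  case (Suc m)
  have "7 / 5 \<le> sqrt 2"
    by (rule real_le_rsqrt) (simp add: power2_eq_square)
  then have "7 / 2 * sqrt (2 ^ m * P) \<le> 5 / 2 * (sqrt 2 * sqrt (2 ^ m * P))"
    using mult_right_mono [of "7 / 5" "sqrt 2" "sqrt (2 ^ m * P)"] assms by simp
  also have "\<dots> = 5 / 2 * sqrt (2 ^ Suc m * P)"
    by (simp add: real_sqrt_mult)
  finally show ?case
    using Suc by simp
qed (use assms in simp)

lemma sum_inverse_power2_le: "(\<Sum>j=m..<n. 1 / 2 ^ j :: real) \<le> 2 / 2 ^ m"
proof (cases "m \<le> n")
  case True
  have "(\<Sum>j=m..<n. 1 / 2 ^ j :: real) = 2 / 2 ^ m - 2 / 2 ^ n"
    using True by (induction n rule: dec_induct) auto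
  then show ?thesis by simp
qed simp

text \<open>The two bounds cross where \<open>2 ^ j\<close> equals \<open>P\<close>; one grows
  geometrically before, the other decays after. Splitting at the first power of two that is at least
  \<open>P\<close> gives \<open>4 * P\<close> and \<open>2 * P\<close>.\<close>

lemma sum_scales_le:
  assumes "P \<ge> 0"
  shows "(\<Sum>j=1..<n. min (sqrt (2 ^ j * P)) (P\<^sup>2 / 2 ^ j)) \<le> 6 * P"
proof -
  obtain k :: nat where "P < 2 ^ k"
    using real_arch_pow [of 2 P] by auto
  then have ex: "\<exists>k. P \<le> 2 ^ k"
    by (auto intro: less_imp_le)
  define m where "m = (LEAST k. P \<le> 2 ^ k)"
  have m: "P \<le> 2 ^ m"
    unfolding m_def using ex by (rule LeastI_ex)
  let ?t = "\<lambda>j. min (sqrt (2 ^ j * P)) (P\<^sup>2 / 2 ^ j)"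
  have low: "(\<Sum>j<m. sqrt (2 ^ j * P)) \<le> 4 * P"
  proof (cases m)
    case (Suc k)
    \<comment> \<open>Minimality of \<open>m\<close> gives that \<open>2 ^ m\<close> is at most
      \<open>2 * P\<close>; with \<open>sqrt 2\<close> rounded up to 8/5 the factor 5/2 becomes 4.
      For \<open>m = 0\<close> the sum is empty.\<close>
    then have "\<not> P \<le> 2 ^ k"
      unfolding m_def by (metis not_less_Least lessI)
    then have "2 ^ m * P \<le> 2 * P\<^sup>2"
      using assms Suc by (simp add: power2_eq_square mult_right_mono)
    also have "\<dots> \<le> (8 / 5 * P)\<^sup>2"
      by (simp add: power2_eq_square)
    finally have "sqrt (2 ^ m * P) \<le> 8 / 5 * P"
      using assms by (intro real_le_lsqrt) auto
    then show ?thesis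
      using sum_sqrt_power2_le [OF assms, of m] by simp
  qed (use assms in simp)
  have "(\<Sum>j=m..<n. P\<^sup>2 / 2 ^ j) = P\<^sup>2 * (\<Sum>j=m..<n. 1 / 2 ^ j)"
    by (simp add: sum_distrib_left)
  also have "\<dots> \<le> P\<^sup>2 * (2 / 2 ^ m)"
    by (intro mult_left_mono sum_inverse_power2_le) auto
  also have "\<dots> \<le> 2 * P"
    using m mult_left_mono [OF m assms] by (simp add: field_simps power2_eq_square)
  finally have high: "(\<Sum>j=m..<n. P\<^sup>2 / 2 ^ j) \<le> 2 * P" .
  have "(\<Sum>j=1..<n. ?t j) \<le> (\<Sum>j\<in>{..<m} \<union> {m..<n}. ?t j)"
    using assms by (intro sum_mono2) auto
  also have "\<dots> = (\<Sum>j<m. ?t j) + (\<Sum>j=m..<n. ?t j)"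
    by (rule sum.union_disjoint) auto
  also have "\<dots> \<le> (\<Sum>j<m. sqrt (2 ^ j * P)) + (\<Sum>j=m..<n. P\<^sup>2 / 2 ^ j)"
    by (intro add_mono sum_mono) auto
  finally show ?thesis
    using low high by simp
qed

subsection \<open>Haar coefficients\<close>

text \<open>Unnormalised horizontal Haar coefficient: left half minus right half of a cell of width
  \<open>2 * s\<close> and height \<open>s\<close>.\<close>

definition haar :: "nat \<Rightarrow> (nat \<times> nat \<Rightarrow> real) \<Rightarrow> nat \<times> nat \<Rightarrow> real" where
  "haar s f c = (\<Sum>v<s. \<Sum>u<s. f (fst c * (2 * s) + u, snd c * s + v) - f (fst c * (2 * s) + s + u, snd c * s + v))"

text \<open>Cells are twice as wide as high, so a square of side \<open>2 * s * K\<close> holds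
  \<open>K\<close> columns and \<open>2 * K\<close> rows of them.\<close>

definition cells :: "nat \<Rightarrow> nat \<Rightarrow> (nat \<times> nat) set" where
  "cells s K = {..<K} \<times> {..<2 * K}"

text \<open>Membership in \<open>S\<close> is the sign of the cell, and the parity of
  \<open>fst p div s\<close> tells its left half from its right half.\<close>

definition positive_at :: "nat \<Rightarrow> (nat \<times> nat) set \<Rightarrow> nat \<times> nat \<Rightarrow> bool" where
  "positive_at s S p \<longleftrightarrow> ((fst p div (2 * s), snd p div s) \<in> S) = even (fst p div s)"

lemma sum_blocks:
  fixes g :: "nat \<Rightarrow> real"
  shows "(\<Sum>x<K * s. g x) = (\<Sum>k<K. \<Sum>u<s. g (k * s + u))"
proof -
  have "(\<Sum>x<K * s. g x) = (\<Sum>k<K. \<Sum>x=k * s..<k * s + s. g x)"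
    by (rule sum.nat_group [symmetric])
  also have "\<dots> = (\<Sum>k<K. \<Sum>u<s. g (k * s + u))"
    by (simp add: sum.atLeastLessThan_shift_0 [of _ "_ * s"] atLeast0LessThan add.commute)
  finally show ?thesis .
qed

lemma sum_double_block:
  fixes g :: "nat \<Rightarrow> real"
  shows "(\<Sum>u<2 * s. g u) = (\<Sum>u<s. g u + g (s + u))"
  using sum_blocks [of g 2 s] by (simp add: numeral_2_eq_2 sum.distrib)

lemma sum_square_cells:
  fixes g :: "nat \<times> nat \<Rightarrow> real"
  assumes "N = 2 * s * K"
  shows "sum g (square N) = (\<Sum>c\<in>cells s K. \<Sum>v<s. \<Sum>u<2 * s. g (fst c * (2 * s) + u, snd c * s + v))"
proof -
  have N: "N = K * (2 * s)" "N = (2 * K) * s"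
    using assms by auto
  have "sum g (square N) = (\<Sum>x<K * (2 * s). \<Sum>y<(2 * K) * s. g (x, y))"
    unfolding square_def N(1) [symmetric] N(2) [symmetric] by (simp add: sum.cartesian_product)
  also have "\<dots> = (\<Sum>k<K. \<Sum>u<2 * s. \<Sum>m<2 * K. \<Sum>v<s. g (k * (2 * s) + u, m * s + v))"
    by (simp only: sum_blocks)
  also have "\<dots> = (\<Sum>k<K. \<Sum>m<2 * K. \<Sum>u<2 * s. \<Sum>v<s. g (k * (2 * s) + u, m * s + v))"
    by (subst sum.swap) simp
  also have "\<dots> = (\<Sum>k<K. \<Sum>m<2 * K. \<Sum>v<s. \<Sum>u<2 * s. g (k * (2 * s) + u, m * s + v))"
    by (intro sum.cong refl sum.swap)
  also have "\<dots> = (\<Sum>c\<in>cells s K. \<Sum>v<s. \<Sum>u<2 * s. g (fst c * (2 * s) + u, snd c * s + v))"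
    unfolding cells_def by (subst sum.cartesian_product) (simp add: case_prod_beta)
  finally show ?thesis .
qed

lemma positive_at_left:
  assumes "u < s" "v < s"
  shows "positive_at s S (k * (2 * s) + u, m * s + v) \<longleftrightarrow> (k, m) \<in> S"
proof -
  have "(k * (2 * s) + u) div (2 * s) = k" "(m * s + v) div s = m"
    using assms by (auto intro!: div_nat_eqI simp: algebra_simps)
  moreover have "(k * (2 * s) + u) div s = 2 * k"
    using assms by (auto intro!: div_nat_eqI simp: algebra_simps)
  ultimately show ?thesis
    by (simp add: positive_at_def)
qed

lemma positive_at_right:
  assumes "u < s" "v < s"
  shows "positive_at s S (k * (2 * s) + s + u, m * s + v) \<longleftrightarrow> (k, m) \<notin> S"
proof -
  have "(k * (2 * s) + s + u) div (2 * s) = k" "(m * s + v) div s = m"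
    using assms by (auto intro!: div_nat_eqI simp: algebra_simps)
  moreover have "(k * (2 * s) + s + u) div s = 2 * k + 1"
    using assms by (auto intro!: div_nat_eqI simp: algebra_simps)
  ultimately show ?thesis
    by (simp add: positive_at_def)
qed

lemma sum_signs_haar:
  assumes "N = 2 * s * K"
  shows "(\<Sum>p\<in>square N. (if positive_at s S p then 1 else - 1) * f p)
    = (\<Sum>c\<in>cells s K. (if c \<in> S then 1 else - 1) * haar s f c)"
  unfolding sum_square_cells [OF assms]
proof (intro sum.cong refl)
  fix c
  show "(\<Sum>v<s. \<Sum>u<2 * s. (if positive_at s S (fst c * (2 * s) + u, snd c * s + v) then 1 else - 1) *
      f (fst c * (2 * s) + u, snd c * s + v)) = (if c \<in> S then 1 else - 1) * haar s f c"
    unfolding sum_double_block haar_def sum_distrib_left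
    using positive_at_left [of _ s _ S "fst c" "snd c"] positive_at_right [of _ s _ S "fst c" "snd c"]
    by (intro sum.cong refl) (auto simp: add.assoc)
qed

lemma abs_haar_indicator_le: "\<bar>haar s (indicator A) c\<bar> \<le> s\<^sup>2"
proof -
  have "\<bar>haar s (indicator A) c\<bar> \<le> (\<Sum>v<s. \<Sum>u<s. 1 :: real)"
    unfolding haar_def
    by (intro order_trans [OF sum_abs] sum_mono) (auto simp: indicator_def)
  then show ?thesis
    by (simp add: power2_eq_square)
qed

lemma sum_abs_haar_le:
  assumes "N = 2 * s * K"
  shows "(\<Sum>c\<in>cells s K. \<bar>haar s f c\<bar>) \<le> (\<Sum>p\<in>square N. \<bar>f p\<bar>)"
  unfolding sum_square_cells [OF assms] sum_double_block haar_def
  by (intro sum_mono order_trans [OF sum_abs]) (auto simp: add.assoc)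

lemma haar_indicator_Compl: "haar s (indicator (- A)) c = - haar s (indicator A) c"
  unfolding haar_def by (simp add: indicator_compl sum_negf [symmetric])

text \<open>Each difference of \<open>f\<close> at distance \<open>s\<close> telescopes into \<open>s\<close> horizontal edges, and every edge is
  used at most \<open>s\<close> times.\<close>

lemma sum_abs_haar_le_TV:
  assumes "N = 2 * s * K"
  shows "(\<Sum>c\<in>cells s K. \<bar>haar s f c\<bar>) \<le> s * TV N f"
proof -
  let ?d = "\<lambda>p. \<bar>f (Suc (fst p), snd p) - f p\<bar>"
  have "(\<Sum>c\<in>cells s K. \<bar>haar s f c\<bar>)
    \<le> (\<Sum>c\<in>cells s K. \<Sum>v<s. s * (\<Sum>w<2 * s. ?d (fst c * (2 * s) + w, snd c * s + v)))"
  proof (intro sum_mono)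
    fix c :: "nat \<times> nat"
    let ?x = "fst c * (2 * s)"
    have "\<bar>haar s f c\<bar> \<le> (\<Sum>v<s. \<Sum>u<s. \<bar>f (?x + u, snd c * s + v) - f (?x + s + u, snd c * s + v)\<bar>)"
      unfolding haar_def by (intro order_trans [OF sum_abs] sum_mono) auto
    also have "\<dots> \<le> (\<Sum>v<s. \<Sum>u<s. \<Sum>w<2 * s. ?d (?x + w, snd c * s + v))"
    proof (intro sum_mono)
      fix u v assume "u \<in> {..<s}"
      then show "\<bar>f (?x + u, snd c * s + v) - f (?x + s + u, snd c * s + v)\<bar>
          \<le> (\<Sum>w<2 * s. ?d (?x + w, snd c * s + v))"
        using abs_diff_le_variation [of u "2 * s" "s + u" "\<lambda>w. f (?x + w, snd c * s + v)"]
        by (simp add: add.assoc)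
    qed
    finally show "\<bar>haar s f c\<bar> \<le> (\<Sum>v<s. s * (\<Sum>w<2 * s. ?d (?x + w, snd c * s + v)))"
      by simp
  qed
  also have "\<dots> = s * sum ?d (square N)"
    unfolding sum_square_cells [OF assms] by (simp add: sum_distrib_left)
  also have "sum ?d (square N) = (\<Sum>y<N. \<Sum>x<N. \<bar>f (Suc x, y) - f (x, y)\<bar>)"
    unfolding square_def by (subst sum.swap) (simp add: sum.cartesian_product case_prod_beta)
  also have "\<dots> \<le> TV N f"
    unfolding TV_eq by (simp add: sum_nonneg)
  finally show ?thesis
    by (simp add: mult_left_mono)
qed

lemma finite_cells [simp]: "finite (cells s K)"
  by (simp add: cells_def)

text \<open>For \<open>P\<^sup>2 / s\<close> the l_2-norm is bounded by the l_1-norm and that by the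
  smaller area. For \<open>sqrt (s * P)\<close> one factor of each square is bounded by the
  half-cell area \<open>s\<^sup>2\<close> and the remaining sum by \<open>s * P\<close>.\<close>

lemma sqrt_sum_haar_indicator_le:
  fixes A :: "(nat \<times> nat) set" and N :: nat
  assumes "N = 2 * s * K" "s > 0"
  defines "P \<equiv> TV N (indicator A)"
  shows "sqrt (\<Sum>c\<in>cells s K. (haar s (indicator A) c)\<^sup>2) / s \<le> min (sqrt (s * P)) (P\<^sup>2 / s)"
proof -
  let ?h = "\<lambda>c. haar s (indicator A) c"
  have P: "P \<ge> 0"
    unfolding P_def by (rule TV_nonneg)
  have card_ind: "(\<Sum>p\<in>square N. \<bar>indicator B p :: real\<bar>) = card (square N \<inter> B)" for B
    by (simp add: indicator_def sum.If_cases)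
  \<comment> \<open>Coefficients of \<open>A\<close> and of its complement agree up to sign, so
    whichever of the two is small in the square may be used.\<close>
  have "(\<Sum>c\<in>cells s K. \<bar>?h c\<bar>) \<le> P\<^sup>2"
    using square_isoperimetric [of N A]
  proof
    assume "card (square N \<inter> A) \<le> (TV N (indicator A))\<^sup>2"
    then show ?thesis
      using sum_abs_haar_le [OF assms(1), of "indicator A"] card_ind [of A] unfolding P_def by simp
  next
    assume "card (square N - A) \<le> (TV N (indicator A))\<^sup>2"
    then show ?thesis
      using sum_abs_haar_le [OF assms(1), of "indicator (- A)"] card_ind [of "- A"]
      unfolding P_def haar_indicator_Compl by (simp add: Diff_eq)
  qed
  moreover have "sqrt (\<Sum>c\<in>cells s K. (?h c)\<^sup>2) \<le> (\<Sum>c\<in>cells s K. \<bar>?h c\<bar>)"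
    using L2_set_le_sum_abs [of ?h "cells s K"] by (simp add: L2_set_def)
  ultimately have 1: "sqrt (\<Sum>c\<in>cells s K. (?h c)\<^sup>2) / s \<le> P\<^sup>2 / s"
    by (intro divide_right_mono) auto
  have "(\<Sum>c\<in>cells s K. (?h c)\<^sup>2) \<le> (\<Sum>c\<in>cells s K. s\<^sup>2 * \<bar>?h c\<bar>)"
  proof (intro sum_mono)
    fix c
    have "(?h c)\<^sup>2 = \<bar>?h c\<bar> * \<bar>?h c\<bar>"
      by (simp add: power2_eq_square)
    also have "\<dots> \<le> s\<^sup>2 * \<bar>?h c\<bar>"
      by (intro mult_right_mono abs_haar_indicator_le) auto
    finally show "(?h c)\<^sup>2 \<le> s\<^sup>2 * \<bar>?h c\<bar>" .
  qed
  also have "\<dots> \<le> s\<^sup>2 * (s * P)"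
    unfolding sum_distrib_left [symmetric] P_def
    by (intro mult_left_mono sum_abs_haar_le_TV assms(1)) auto
  finally have "sqrt (\<Sum>c\<in>cells s K. (?h c)\<^sup>2) \<le> sqrt (s\<^sup>2 * (s * P))"
    by simp
  also have "\<dots> = s * sqrt (s * P)"
    using P by (simp add: real_sqrt_mult)
  finally have "sqrt (\<Sum>c\<in>cells s K. (?h c)\<^sup>2) / s \<le> sqrt (s * P)"
    using assms(2) by (simp add: field_simps)
  with 1 show ?thesis by simp
qed

subsection \<open>Signed tents\<close>

text \<open>Distance from \<open>x\<close> to the nearest multiple of \<open>s\<close>, for positive
  \<open>s\<close>.\<close>

definition tent :: "int \<Rightarrow> int \<Rightarrow> real" where
  "tent s x = of_int (min (x mod s) (s - x mod s))"

text \<open>One bump on each \<open>s\<close> by \<open>s\<close> block. It vanishes on the block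
  boundary, which leaves the signs free; as a tent is at most \<open>s / 2\<close>, the factor
  \<open>2 / s\<close> makes the product 1-Lipschitz in each coordinate.\<close>

definition signed_tents :: "int \<Rightarrow> (int \<Rightarrow> int \<Rightarrow> bool) \<Rightarrow> int \<times> int \<Rightarrow> real" where
  "signed_tents s \<theta> p = (if \<theta> (fst p div s) (snd p div s) then 1 else - 1)
    * (2 / s * tent s (fst p) * tent s (snd p))"

lemma tent_nonneg: "s > 0 \<Longrightarrow> 0 \<le> tent s x"
  by (simp add: tent_def less_imp_le)

lemma tent_le: "2 * tent s x \<le> s"
  unfolding tent_def by (simp add: min_def)

text \<open>The second alternative is a step into the next block, where the sign may jump: the new
  value is 0 and the old one at most 1.\<close>

lemma tent_step:
  assumes "s > 0"
  shows "(x + 1) div s = x div s \<and> \<bar>tent s (x + 1) - tent s x\<bar> \<le> 1 \<or> tent s (x + 1) = 0 \<and> tent s x \<le> 1"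
proof (cases "x mod s + 1 < s")
  case True
  have "(x + 1) div s = x div s" "(x + 1) mod s = x mod s + 1"
    using True assms int_div_pos_eq [of "x + 1" s "x div s" "x mod s + 1"]
      int_mod_pos_eq [of "x + 1" s "x div s" "x mod s + 1"] by simp_all
  then show ?thesis
    by (auto simp: tent_def min_def)
next
  case False
  then have m: "x mod s = s - 1"
    using pos_mod_bound [OF assms, of x] by simp
  have "x + 1 = s * (x div s) + x mod s + 1"
    by simp
  also have "\<dots> = s * (x div s + 1)"
    unfolding m by (simp add: algebra_simps)
  finally have "(x + 1) mod s = 0"
    by simp
  then show ?thesis
    using assms m by (simp add: tent_def)
qed

lemma signed_tents_Lipschitz:
  assumes "s > 0"
  shows "\<bar>signed_tents s \<theta> p - signed_tents s \<theta> q\<bar> \<le> l1dist p q"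
proof (rule l1dist_Lipschitz_of_steps)
  \<comment> \<open>\<open>P\<close> and \<open>Q\<close> stand for the two signs, so that the same
    statement serves both coordinate directions.\<close>
  have step: "\<bar>(if P then 1 else - 1) * (2 / s * tent s (x + 1) * tent s y)
      - (if Q then 1 else - 1) * (2 / s * tent s x * tent s y)\<bar> \<le> 1"
    if PQ: "(x + 1) div s = x div s \<Longrightarrow> P = Q" for P Q x y
  proof -
    define c where "c = 2 / s * tent s y"
    have c: "0 \<le> c" "c \<le> 1"
      unfolding c_def using assms tent_nonneg [OF assms, of y] tent_le [of s y] by (auto simp: field_simps)
    have bound: "\<bar>c * z\<bar> \<le> 1" if "\<bar>z\<bar> \<le> 1" for z :: real
      using mult_mono [OF c(2) that] c(1) by (simp add: abs_mult)
    from tent_step [OF assms, of x] show ?thesis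
    proof
      assume a: "(x + 1) div s = x div s \<and> \<bar>tent s (x + 1) - tent s x\<bar> \<le> 1"
      then have "P = Q"
        using PQ by blast
      then have "(if P then 1 else - 1) * (2 / s * tent s (x + 1) * tent s y)
          - (if Q then 1 else - 1) * (2 / s * tent s x * tent s y)
          = (if Q then 1 else - 1) * (c * (tent s (x + 1) - tent s x))"
        by (simp add: c_def right_diff_distrib diff_divide_distrib mult_ac)
      then show ?thesis
        using bound a by (simp add: abs_mult)
    next
      assume a: "tent s (x + 1) = 0 \<and> tent s x \<le> 1"
      then have "\<bar>(if P then 1 else - 1) * (2 / s * tent s (x + 1) * tent s y)
          - (if Q then 1 else - 1) * (2 / s * tent s x * tent s y)\<bar> = \<bar>c * tent s x\<bar>"
        using a by (auto simp: c_def algebra_simps)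
      then show ?thesis
        using bound [of "tent s x"] a tent_nonneg [OF assms, of x] by simp
    qed
  qed
  show "\<bar>signed_tents s \<theta> (x + 1, y) - signed_tents s \<theta> (x, y)\<bar> \<le> 1" for x y
    unfolding signed_tents_def fst_conv snd_conv by (rule step) simp
  show "\<bar>signed_tents s \<theta> (x, y + 1) - signed_tents s \<theta> (x, y)\<bar> \<le> 1" for x y
    using step [of y "\<theta> (x div s) ((y + 1) div s)" "\<theta> (x div s) (y div s)" x]
    by (simp add: signed_tents_def mult_ac)
qed

text \<open>Within a period the values at \<open>u\<close> and \<open>r + u\<close> are
  \<open>u\<close> and \<open>r - u\<close>, so each such pair contributes \<open>r\<close>.\<close>

lemma sum_tent:
  assumes "r > 0"
  shows "(\<Sum>x<K * (2 * r). tent (int (2 * r)) (int x)) = real K * (real r)\<^sup>2"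
proof -
  let ?t = "\<lambda>x. tent (int (2 * r)) (int x)"
  have pair: "?t (k * (2 * r) + u) + ?t (k * (2 * r) + (r + u)) = r"
    if "u < r" for k u
  proof -
    have "int (k * (2 * r) + u) mod int (2 * r) = int u"
      "int (k * (2 * r) + (r + u)) mod int (2 * r) = int (r + u)"
      using that unfolding of_nat_mod [symmetric] by simp_all
    then show ?thesis
      using that by (simp add: tent_def min_def)
  qed
  have "(\<Sum>x<K * (2 * r). ?t x) = (\<Sum>k<K. \<Sum>u<2 * r. ?t (k * (2 * r) + u))"
    by (rule sum_blocks)
  also have "\<dots> = (\<Sum>k<K. \<Sum>u<r. ?t (k * (2 * r) + u) + ?t (k * (2 * r) + (r + u)))"
    by (simp only: sum_double_block)
  also have "\<dots> = (\<Sum>k<K. \<Sum>u<r. real r)"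
    by (intro sum.cong refl pair) simp
  finally show ?thesis
    by (simp add: power2_eq_square)
qed

lemma sum_tent_product:
  assumes "r > 0" "s = 2 * r" "N = K * s"
  shows "(\<Sum>p\<in>square N. 2 / real s * tent (int s) (int (fst p)) * tent (int s) (int (snd p))) = (real N)\<^sup>2 * real s / 8"
proof -
  have "(\<Sum>p\<in>square N. 2 / real s * tent (int s) (int (fst p)) * tent (int s) (int (snd p)))
    = 2 / real s * ((\<Sum>x<N. tent (int s) (int x)) * (\<Sum>y<N. tent (int s) (int y)))"
    unfolding square_def sum_product unfolding sum_distrib_left
    by (simp add: sum.cartesian_product case_prod_beta mult.assoc)
  also have "(\<Sum>x<N. tent (int s) (int x)) = real K * (real r)\<^sup>2"
    unfolding assms(2,3) by (rule sum_tent [OF assms(1)])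
  also have "2 / real s * (real K * (real r)\<^sup>2 * (real K * (real r)\<^sup>2)) = (real N)\<^sup>2 * real s / 8"
    using assms by (simp add: power2_eq_square field_simps)
  finally show ?thesis .
qed

subsection \<open>The linear inequality on the dyadic square\<close>

definition dyadic_cells :: "nat \<Rightarrow> nat \<Rightarrow> (nat \<times> nat) set" where
  "dyadic_cells n j = cells (2 ^ j) (2 ^ (n - j - 1))"

definition pos :: "nat \<Rightarrow> nat \<times> (nat \<times> nat) set \<Rightarrow> (nat \<times> nat) set" where
  "pos n = (\<lambda>(j, S). {p \<in> square (2 ^ n). positive_at (2 ^ j) S p})"

definition neg :: "nat \<Rightarrow> nat \<times> (nat \<times> nat) set \<Rightarrow> (nat \<times> nat) set" where
  "neg n = (\<lambda>(j, S). {p \<in> square (2 ^ n). \<not> positive_at (2 ^ j) S p})"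

text \<open>Scales start at \<open>j = 1\<close>, since a tent of period 1 is identically 0, and end
  where a cell is as wide as the square.\<close>

definition signs :: "nat \<Rightarrow> (nat \<times> (nat \<times> nat) set) set" where
  "signs n = (SIGMA j:{1..<n}. Pow (dyadic_cells n j))"

text \<open>The power \<open>2 ^ card\<close> averages over the sign patterns, \<open>2 ^ j\<close>
  normalises the scale, and 6 is the constant of \<open>sum_scales_le\<close>.\<close>

definition weight :: "nat \<Rightarrow> nat \<times> (nat \<times> nat) set \<Rightarrow> real" where
  "weight n = (\<lambda>(j, S). 1 / (6 * 2 ^ j * 2 ^ card (dyadic_cells n j)))"

lemma dyadic_side:
  assumes "j < n"
  shows "(2 :: nat) ^ n = 2 * 2 ^ j * 2 ^ (n - j - 1)"
proof -
  have "n = Suc (j + (n - j - 1))"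
    using assms by simp
  then show ?thesis
    by (metis power_Suc power_add mult.assoc)
qed

lemma finite_dyadic_cells [simp]: "finite (dyadic_cells n j)"
  by (simp add: dyadic_cells_def)

lemma finite_signs [simp]: "finite (signs n)"
  by (simp add: signs_def)

lemma sum_pos_neg: "sum f (pos n (j, S)) - sum f (neg n (j, S))
    = (\<Sum>p\<in>square (2 ^ n). (if positive_at (2 ^ j) S p then 1 else - 1) * f p :: real)"
proof -
  have "(\<Sum>p\<in>square (2 ^ n). (if positive_at (2 ^ j) S p then 1 else - 1) * f p)
    = (\<Sum>p\<in>square (2 ^ n). if positive_at (2 ^ j) S p then f p else - f p)"
    by (intro sum.cong) auto
  also have "\<dots> = sum f (pos n (j, S)) + (\<Sum>p\<in>neg n (j, S). - f p)"
    unfolding pos_def neg_def by (subst sum.If_cases) (auto intro!: arg_cong2 [where f = "(+)"] sum.cong)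
  finally show ?thesis
    by (simp add: sum_negf)
qed

lemma sum_pos_neg_haar:
  assumes "j < n"
  shows "sum f (pos n (j, S)) - sum f (neg n (j, S))
    = (\<Sum>c\<in>dyadic_cells n j. (if c \<in> S then 1 else - 1) * haar (2 ^ j) f c)"
  unfolding sum_pos_neg dyadic_cells_def by (rule sum_signs_haar [OF dyadic_side [OF assms]])

text \<open>The Haar coefficients of a constant vanish.\<close>

lemma card_pos_eq_card_neg:
  assumes "j < n"
  shows "card (pos n (j, S)) = card (neg n (j, S))"
  using sum_pos_neg_haar [OF assms, of "\<lambda>_. 1" S] by (simp add: haar_def)

text \<open>At each scale the average over signs is at most the l_2-norm of the Haar coefficients;
  the resulting minima sum to at most \<open>6 * P\<close>.\<close>

lemma sum_weight_indicator_le: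
  "(\<Sum>i\<in>signs n. weight n i * \<bar>sum (indicator A) (pos n i) - sum (indicator A) (neg n i)\<bar>)
    \<le> TV (2 ^ n) (indicator A)"
proof -
  define P where "P = TV (2 ^ n) (indicator A)"
  have "(\<Sum>i\<in>signs n. weight n i * \<bar>sum (indicator A) (pos n i) - sum (indicator A) (neg n i)\<bar>)
    = (\<Sum>j=1..<n. \<Sum>S\<in>Pow (dyadic_cells n j). weight n (j, S) *
        \<bar>sum (indicator A) (pos n (j, S)) - sum (indicator A) (neg n (j, S))\<bar>)"
    unfolding signs_def by (subst sum.Sigma) (auto simp: case_prod_beta)
  also have "\<dots> \<le> (\<Sum>j=1..<n. min (sqrt (2 ^ j * P)) (P\<^sup>2 / 2 ^ j) / 6)"
  proof (intro sum_mono)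
    fix j assume "j \<in> {1..<n}"
    then have j: "j < n" by simp
    let ?C = "dyadic_cells n j"
    have "(\<Sum>S\<in>Pow ?C. weight n (j, S) * \<bar>sum (indicator A) (pos n (j, S)) - sum (indicator A) (neg n (j, S))\<bar>)
      = (\<Sum>S\<in>Pow ?C. \<bar>\<Sum>c\<in>?C. (if c \<in> S then 1 else - 1) * haar (2 ^ j) (indicator A) c\<bar>)
        / (6 * 2 ^ j * 2 ^ card ?C)"
      unfolding sum_pos_neg_haar [OF j] weight_def by (simp add: sum_divide_distrib)
    also have "\<dots> \<le> 2 ^ card ?C * sqrt (\<Sum>c\<in>?C. (haar (2 ^ j) (indicator A) c)\<^sup>2) / (6 * 2 ^ j * 2 ^ card ?C)"
      by (intro divide_right_mono random_signs_first_moment) auto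
    also have "\<dots> = sqrt (\<Sum>c\<in>?C. (haar (2 ^ j) (indicator A) c)\<^sup>2) / real (2 ^ j) / 6"
      by simp
    also have "\<dots> \<le> min (sqrt (2 ^ j * P)) (P\<^sup>2 / 2 ^ j) / 6"
      using sqrt_sum_haar_indicator_le [OF dyadic_side [OF j], of A]
      unfolding P_def dyadic_cells_def by (intro divide_right_mono) simp_all
    finally show "(\<Sum>S\<in>Pow ?C. weight n (j, S) *
        \<bar>sum (indicator A) (pos n (j, S)) - sum (indicator A) (neg n (j, S))\<bar>)
      \<le> min (sqrt (2 ^ j * P)) (P\<^sup>2 / 2 ^ j) / 6" .
  qed
  also have "\<dots> \<le> P"
    using sum_scales_le [of P n] TV_nonneg [of "2 ^ n" "indicator A"]
    by (simp add: P_def sum_divide_distrib [symmetric])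
  finally show ?thesis
    unfolding P_def .
qed

lemma sum_weight_le_TV:
  "(\<Sum>i\<in>signs n. weight n i * \<bar>sum f (pos n i) - sum f (neg n i)\<bar>) \<le> (\<Sum>(p, q)\<in>edges (2 ^ n). \<bar>f p - f q\<bar>)"
proof (rule coarea_reduction [where X = "{..2 ^ n} \<times> {..2 ^ n}"])
  show "edges (2 ^ n) \<subseteq> ({..2 ^ n} \<times> {..2 ^ n}) \<times> ({..2 ^ n} \<times> {..2 ^ n})"
    by (auto simp: edges_def square_def)
  show "(\<Sum>i\<in>signs n. weight n i * \<bar>sum (indicator A) (pos n i) - sum (indicator A) (neg n i)\<bar>)
      \<le> (\<Sum>(p, q)\<in>edges (2 ^ n). \<bar>indicator A p - indicator A q\<bar>)" for A
    using sum_weight_indicator_le unfolding TV_def .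
  show "card (pos n i) = card (neg n i)" if "i \<in> signs n" for i
    using that card_pos_eq_card_neg by (auto simp: signs_def)
qed (auto simp: weight_def pos_def neg_def square_def)

subsection \<open>Integer combinations of point masses\<close>

text \<open>The total mass is absorbed at the origin, so that the lattice is all of
  \<open>int \<times> int \<Rightarrow> int\<close> and no membership conditions arise.\<close>

definition to_TC :: "nat \<Rightarrow> (int \<times> int \<Rightarrow> int) \<Rightarrow> int \<times> int \<Rightarrow> real" where
  "to_TC n v p = (if p \<in> Gr n then of_int (v p) - (if p = (0, 0) then of_int (sum v (Gr n)) else 0) else 0)"

definition point_mass :: "nat \<times> nat \<Rightarrow> int \<times> int \<Rightarrow> int" where
  "point_mass q p = (if p = (int (fst q), int (snd q)) then 1 else 0)"

lemma finite_Gr [simp]: "finite (Gr n)"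
  by (simp add: Gr_def)

lemma zero_in_Gr [simp]: "(0, 0) \<in> Gr n"
  by (simp add: Gr_def)

lemma to_TC_in_TC: "to_TC n v \<in> TC (Gr n)"
  by (simp add: TC_def to_TC_def sum_subtractf)

lemma to_TC_diff: "to_TC n (v - w) = (\<lambda>p. to_TC n v p - to_TC n w p)"
  by (auto simp: to_TC_def fun_eq_iff sum_subtractf)

text \<open>Gives access to the rules for additive maps, by which the pairing passes through sums,
  differences and multiples of point masses.\<close>

lemma additive_to_TC_pairing: "Modules.additive (\<lambda>v. \<Sum>p\<in>Gr n. \<phi> p * to_TC n v p)"
proof
  have "to_TC n (v + w) p = to_TC n v p + to_TC n w p" for v w p
    by (simp add: to_TC_def sum.distrib)
  then show "(\<Sum>p\<in>Gr n. \<phi> p * to_TC n (v + w) p)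
      = (\<Sum>p\<in>Gr n. \<phi> p * to_TC n v p) + (\<Sum>p\<in>Gr n. \<phi> p * to_TC n w p)" for v w
    by (simp add: distrib_left sum.distrib)
qed

lemma to_TC_pairing_point_mass:
  assumes "q \<in> {..2 ^ n} \<times> {..2 ^ n}"
  shows "(\<Sum>p\<in>Gr n. \<phi> p * to_TC n (point_mass q) p) = \<phi> (int (fst q), int (snd q)) - \<phi> (0, 0)"
proof -
  let ?q = "(int (fst q), int (snd q))"
  have q: "?q \<in> Gr n"
    using assms by (auto simp: Gr_def)
  then have "sum (point_mass q) (Gr n) = 1"
    by (simp add: point_mass_def)
  then have "(\<Sum>p\<in>Gr n. \<phi> p * to_TC n (point_mass q) p)
    = (\<Sum>p\<in>Gr n. (if p = ?q then \<phi> p else 0) - (if p = (0, 0) then \<phi> p else 0))"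
    by (intro sum.cong refl) (auto simp: to_TC_def point_mass_def)
  then show ?thesis
    using q by (simp add: sum_subtractf)
qed

lemma tc_norm_edge:
  assumes "(p, q) \<in> edges (2 ^ n)"
  shows "tc_norm (Gr n) l1dist (to_TC n (point_mass p - point_mass q)) \<le> 1"
proof -
  let ?i = "\<lambda>p. (int (fst p), int (snd p))"
  have Gr: "?i p \<in> Gr n" "?i q \<in> Gr n"
    using assms by (auto simp: Gr_def edges_def square_def)
  \<comment> \<open>With total mass 0 the correction at the origin disappears.\<close>
  have mass: "sum (point_mass p - point_mass q) (Gr n) = 0"
    using Gr by (simp add: point_mass_def sum_subtractf)
  have "to_TC n (point_mass p - point_mass q) z
      = (if z \<in> Gr n then of_int ((point_mass p - point_mass q) z) else 0)" for z
    unfolding to_TC_def mass by simp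
  then have "to_TC n (point_mass p - point_mass q) = (\<lambda>z. (if z = ?i p then 1 else 0) - (if z = ?i q then 1 else 0))"
    using Gr by (auto simp: point_mass_def)
  then have "tc_norm (Gr n) l1dist (to_TC n (point_mass p - point_mass q)) \<le> l1dist (?i p) (?i q)"
    using tc_norm_le_point_masses [OF Gr, of l1dist] by (simp add: l1dist_def)
  also have "\<dots> = 1"
    using assms by (auto simp: l1dist_def edges_def)
  finally show ?thesis .
qed

text \<open>Duality with tents whose signs follow those of the measure: the pairing becomes a sum of
  unsigned tents, and additivity supplies the factor \<open>K\<close>.\<close>

lemma tc_norm_signed_sum_ge:
  fixes S :: "(nat \<times> nat) set" and n j :: nat
  assumes "1 \<le> j" "j < n"
  defines "v \<equiv> sum point_mass (pos n (j, S)) - sum point_mass (neg n (j, S))"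
  shows "real K * (real (2 ^ n))\<^sup>2 * 2 ^ j / 8 \<le> tc_norm (Gr n) l1dist (to_TC n (nmul K v))"
proof -
  define s where "s = (2 :: nat) ^ j"
  \<comment> \<open>Block \<open>(k, m)\<close> of side \<open>s\<close> is half of the cell
    \<open>(k div 2, m)\<close>, the left half for even \<open>k\<close>; this repeats
    \<open>positive_at\<close> on block indices.\<close>
  define \<theta> where "\<theta> = (\<lambda>k m. ((nat (k div 2), nat m) \<in> S) = even (k :: int))"
  define \<phi> where "\<phi> = signed_tents (int s) \<theta>"
  let ?i = "\<lambda>p. (int (fst p), int (snd p))"
  interpret Modules.additive "\<lambda>v. \<Sum>p\<in>Gr n. \<phi> p * to_TC n v p"
    by (rule additive_to_TC_pairing)
  have mass: "(\<Sum>p\<in>Gr n. \<phi> p * to_TC n (point_mass q) p) = \<phi> (?i q) - \<phi> (0, 0)"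
    if "q \<in> square (2 ^ n)" for q
    using that by (intro to_TC_pairing_point_mass) (auto simp: square_def)
  have mass_sum: "(\<Sum>q\<in>T. \<Sum>p\<in>Gr n. \<phi> p * to_TC n (point_mass q) p) = (\<Sum>q\<in>T. \<phi> (?i q)) - card T * \<phi> (0, 0)"
    if "T \<subseteq> square (2 ^ n)" for T
  proof -
    have "(\<Sum>q\<in>T. \<Sum>p\<in>Gr n. \<phi> p * to_TC n (point_mass q) p) = (\<Sum>q\<in>T. \<phi> (?i q) - \<phi> (0, 0))"
      by (intro sum.cong refl mass) (use that in auto)
    then show ?thesis
      by (simp add: sum_subtractf)
  qed
  have "pos n (j, S) \<subseteq> square (2 ^ n)" "neg n (j, S) \<subseteq> square (2 ^ n)"
    by (auto simp: pos_def neg_def)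
  \<comment> \<open>The terms \<open>\<phi> (0, 0)\<close> coming from the origin cancel, as both
    sets have the same cardinality.\<close>
  then have "(\<Sum>p\<in>Gr n. \<phi> p * to_TC n v p)
    = (\<Sum>q\<in>pos n (j, S). \<phi> (?i q)) - (\<Sum>q\<in>neg n (j, S). \<phi> (?i q))"
    unfolding v_def diff sum using mass_sum card_pos_eq_card_neg [OF assms(2), of S] by simp
  also have "\<dots> = (\<Sum>p\<in>square (2 ^ n). (if positive_at (2 ^ j) S p then 1 else - 1) * \<phi> (?i p))"
    by (rule sum_pos_neg)
  also have "\<dots> = (\<Sum>p\<in>square (2 ^ n). 2 / real s * tent (int s) (int (fst p)) * tent (int s) (int (snd p)))"
  proof (intro sum.cong refl)
    fix p :: "nat \<times> nat"
    have "\<theta> (int (fst p) div int s) (int (snd p) div int s) = positive_at s S p"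
      unfolding \<theta>_def positive_at_def of_nat_div [symmetric]
      by (simp add: nat_div_distrib div_mult2_eq [symmetric] mult.commute)
    then show "(if positive_at (2 ^ j) S p then 1 else - 1) * \<phi> (?i p)
        = 2 / real s * tent (int s) (int (fst p)) * tent (int s) (int (snd p))"
      unfolding \<phi>_def signed_tents_def s_def by simp
  qed
  also have "\<dots> = (real (2 ^ n))\<^sup>2 * real s / 8"
  proof (rule sum_tent_product)
    show "s = 2 * 2 ^ (j - 1)"
      using assms(1) by (simp add: s_def power_eq_if)
    show "2 ^ n = 2 ^ (n - j) * s"
      using assms(2) by (simp add: s_def power_add [symmetric])
  qed simp
  finally have pairing: "(\<Sum>p\<in>Gr n. \<phi> p * to_TC n v p) = (real (2 ^ n))\<^sup>2 * 2 ^ j / 8"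
    by (simp add: s_def)
  have "real K * ((real (2 ^ n))\<^sup>2 * 2 ^ j / 8) = (\<Sum>p\<in>Gr n. \<phi> p * to_TC n (nmul K v) p)"
    unfolding nmul_def sum pairing by simp
  also have "\<dots> \<le> tc_norm (Gr n) l1dist (to_TC n (nmul K v))"
  proof (rule tc_norm_ge_Lipschitz)
    fix p q
    show "\<phi> p - \<phi> q \<le> l1dist p q"
      using signed_tents_Lipschitz [of "int s" \<theta> p q] unfolding \<phi>_def s_def by simp
  qed (simp_all add: to_TC_in_TC)
  finally show ?thesis
    by simp
qed

section \<open>The lower bound for the distortion\<close>

lemma L1_distortion_ge:
  assumes "L1_embedding (TC (Gr n)) (tc_dist (Gr n) l1dist) M F D"
  shows "(real n - 1) / 96 \<le> D"
proof (cases "n \<ge> 1")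
  case False
  then show ?thesis
    using assms by (simp add: L1_embedding_def)
next
  case n: True
  define H where "H = (\<lambda>v. F (to_TC n v))"
  define B where "B = (\<lambda>v. D * tc_norm (Gr n) l1dist (to_TC n v))"
  define lam where "lam = (\<lambda>(j, S :: (nat \<times> nat) set). (real (2 ^ n))\<^sup>2 * 2 ^ j / 8)"
  have D: "D \<ge> 1" and int: "\<And>v. integrable M (H v)"
    using assms to_TC_in_TC unfolding L1_embedding_def H_def by auto
  have lower: "tc_norm (Gr n) l1dist (to_TC n (v - w)) \<le> (\<integral>t. \<bar>H v t - H w t\<bar> \<partial>M)"
    and upper: "(\<integral>t. \<bar>H v t - H w t\<bar> \<partial>M) \<le> B (v - w)" for v w
    using assms to_TC_in_TC unfolding L1_embedding_def H_def B_def to_TC_diff tc_dist_def by auto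
  have "(\<Sum>i\<in>signs n. weight n i * lam i) \<le> (\<Sum>(p, q)\<in>edges (2 ^ n). B (point_mass p - point_mass q))"
  proof (rule linearization [where F = H and P = "pos n" and Q = "neg n" and X = "square (2 ^ n)"])
    fix i K x assume "i \<in> signs n"
    then obtain j S where i: "i = (j, S)" "1 \<le> j" "j < n"
      by (auto simp: signs_def)
    define v where "v = sum point_mass (pos n i) - sum point_mass (neg n i)"
    have "real K * lam i \<le> tc_norm (Gr n) l1dist (to_TC n (nmul K v))"
      using tc_norm_signed_sum_ge [OF i(2,3), of K S] unfolding lam_def v_def i(1) by simp
    also have "\<dots> \<le> (\<integral>t. \<bar>H (x + nmul K v) t - H x t\<bar> \<partial>M)"
      using lower [of "x + nmul K v" x] by simp
    finally show "real K * lam i \<le> (\<integral>t. \<bar>H (x + nmul K (sum point_mass (pos n i) - sum point_mass (neg n i))) t - H x t\<bar> \<partial>M)"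
      unfolding v_def .
    show "0 \<le> weight n i"
      by (simp add: weight_def i(1))
    show "pos n i \<subseteq> square (2 ^ n)" "neg n i \<subseteq> square (2 ^ n)"
      by (auto simp: pos_def neg_def i(1))
  qed (rule int upper sum_weight_le_TV finite_signs finite_square)+
  \<comment> \<open>An edge is a transport of unit mass over distance 1, hence costs at most
    \<open>D\<close>.\<close>
  also have "\<dots> \<le> (\<Sum>(p, q)\<in>edges (2 ^ n). D)"
  proof (intro sum_mono, clarify)
    fix p q assume "(p, q) \<in> edges (2 ^ n)"
    then show "B (point_mass p - point_mass q) \<le> D"
      using mult_left_mono [OF tc_norm_edge, of p q n D] D unfolding B_def by simp
  qed
  also have "\<dots> \<le> 2 * (real (2 ^ n))\<^sup>2 * D"
  proof -
    have "real (card (edges (2 ^ n))) \<le> real (2 * (2 ^ n)\<^sup>2)"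
      by (rule of_nat_mono [OF card_edges_le])
    then show ?thesis
      using D by (simp add: mult_right_mono case_prod_beta)
  qed
  also have "(\<Sum>i\<in>signs n. weight n i * lam i)
      = (\<Sum>j=1..<n. \<Sum>S\<in>Pow (dyadic_cells n j). weight n (j, S) * lam (j, S))"
    unfolding signs_def by (subst sum.Sigma) (auto simp: case_prod_beta)
  \<comment> \<open>The number of sign patterns and the factor \<open>2 ^ j\<close> cancel, so all
    scales contribute equally; 48 is 6 from the weight times 8 from the tents.\<close>
  also have "\<dots> = (\<Sum>j=1..<n. (real (2 ^ n))\<^sup>2 / 48)"
    by (intro sum.cong refl) (simp add: weight_def lam_def card_Pow)
  also have "\<dots> = (real n - 1) * (real (2 ^ n))\<^sup>2 / 48"
    using n by simp
  finally have "(real n - 1) / 48 * (real (2 ^ n))\<^sup>2 \<le> 2 * D * (real (2 ^ n))\<^sup>2"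
    by (simp add: mult_ac)
  then have "(real n - 1) / 48 \<le> 2 * D"
    by (rule mult_right_le_imp_le) simp
  then show ?thesis
    by simp
qed

theorem theorem3p9:
  fixes n :: nat and M :: "'a measure" and F :: "(int \<times> int \<Rightarrow> real) \<Rightarrow> 'a \<Rightarrow> real" and D :: real
  assumes "n \<ge> 2"
    and "L1_embedding (TC (Gr n)) (tc_dist (Gr n) l1dist) M F D"
  shows "D \<ge> (real n - 1) / 5760"
  using L1_distortion_ge [OF assms(2)] assms(1) by simp

end
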